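(* Let $1\le p\le\infty$ and let $q$ be its conjugate exponent, $1/p+1/q=1$ (with $1/\infty=0$). Let $n\ge 1$ be an integer and define $$C_{p,n}=\frac{n!}{\pi}\,2^{\,n+1-1/q}\max_{0\le\beta\le\pi/2}F_q(\beta)^{1/q},$$ $$F_q(\beta)=\int_0^{\pi}\left|\sin^{(n+1)-2/q}(v)\,\cos\!\left[v(n+1)+\beta-\tfrac{\pi}{2}(n-1)\right]\right|^q dv .$$ (For $q=\infty$, i.e. $p=1$, $F_q(\beta)^{1/q}$ is understood as $\sup_{0\le v\le\pi}\left|\sin^{n+1}(v)\cos[v(n+1)+\beta-\frac{\pi}{2}(n-1)]\right|$ and $1/q=0$.) Let $f$ be analytic on the unit disk $\mathbf U$ with $\Re f\in h^p(\mathbf U)$, and let $\mathcal P_l$ be a polynomial (with complex coefficients) of degree $l\le n-1$. Then for every $z\in\mathbf U$, with $r=|z|$, $$|f^{(n)}(z)|\le C_{p,n}\,(1-r^2)^{-1/p-n}\,\|\Re(f-\mathcal P_l)\|_{h^p},$$ and this inequality is sharp: for given $p$ and $n$, the constant $C_{p,n}$ cannot be replaced by any smaller constant independent of $f$, $\mathcal P_l$ and $z$. In particular, $$|f^{(n)}(z)|\le C_{p,n}\,(1-r^2)^{-1/p-n}\,E_{n-1,p}(\Re f).$$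
   Context: $\mathbf U=\{z\in\mathbb C:|z|<1\}$. For $1\le p<\infty$, $h^p(\mathbf U)$ is the space of harmonic functions $u$ on $\mathbf U$ with $$\|u\|_{h^p}=\left(\sup_{0<r<1}\int_0^{2\pi}|u(re^{it})|^p\,dt\right)^{1/p}<\infty$$ (the measure $dt$ is not normalized). $h^\infty(\mathbf U)$ is the space of bounded harmonic functions on $\mathbf U$, with $\|u\|_{h^\infty}=\sup_{\mathbf U}|u|$. For an integer $m\ge 0$, $\mathfrak P_m$ is the set of all algebraic polynomials with complex coefficients of degree at most $m$, and $$E_{m,p}(\Re f)=\inf_{\mathcal P\in\mathfrak P_m}\|\Re(f-\mathcal P)\|_{h^p}.$$ *)

theory Defs
  imports "HOL-Analysis.Analysis" "HOL-Computational_Algebra.Polynomial"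
begin

text \<open>Real-valued harmonic functions on a set (meant to be open): twice continuously
  (Frechet) differentiable, with vanishing Laplacian.  The directions \<open>1\<close> and \<open>\<i>\<close> are the
  two coordinate directions of the plane, so \<open>u'' z 1 1\<close> and \<open>u'' z \<i> \<i>\<close> are the two
  unmixed second partial derivatives.\<close>

definition harmonic_on :: "(complex \<Rightarrow> real) \<Rightarrow> complex set \<Rightarrow> bool"
    (infixl \<open>(harmonic'_on)\<close> 50) where
  "u harmonic_on S \<longleftrightarrow>
     (\<exists>(u' :: complex \<Rightarrow> complex \<Rightarrow>\<^sub>L real)
       (u'' :: complex \<Rightarrow> complex \<Rightarrow>\<^sub>L complex \<Rightarrow>\<^sub>L real).
        (\<forall>z\<in>S. (u has_derivative blinfun_apply (u' z)) (at z)) \<and>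
        (\<forall>z\<in>S. (u' has_derivative blinfun_apply (u'' z)) (at z)) \<and>
        continuous_on S u'' \<and>
        (\<forall>z\<in>S. blinfun_apply (blinfun_apply (u'' z) 1) 1
               + blinfun_apply (blinfun_apply (u'' z) \<i>) \<i> = 0))"

text \<open>Exponents in \<open>[1,\<infinity>]\<close> are extended nonnegative reals.  Note that
  \<open>enn2real (1 / \<infinity>) = 0\<close>, so \<open>enn2real (1 / p)\<close> is \<open>1/p\<close> with \<open>1/\<infinity> = 0\<close>.\<close>

definition circle_integral :: "real \<Rightarrow> (complex \<Rightarrow> real) \<Rightarrow> real \<Rightarrow> real" where
  "circle_integral p u r =
     integral {0..2 * pi} (\<lambda>t. \<bar>u (complex_of_real r * cis t)\<bar> powr p)"

definition hp :: "ennreal \<Rightarrow> (complex \<Rightarrow> real) set" where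
  "hp p = {u. u harmonic_on ball 0 1 \<and>
     (if p = \<infinity> then bdd_above ((\<lambda>z. \<bar>u z\<bar>) ` ball 0 1)
      else bdd_above (circle_integral (enn2real p) u ` {0<..<1}))}"

text \<open>Only meaningful on \<^term>\<open>hp p\<close>, where the suprema are finite.\<close>

definition hp_norm :: "ennreal \<Rightarrow> (complex \<Rightarrow> real) \<Rightarrow> real" where
  "hp_norm p u =
     (if p = \<infinity> then (SUP z\<in>ball 0 1. \<bar>u z\<bar>)
      else (SUP r\<in>{0<..<1}. circle_integral (enn2real p) u r) powr (1 / enn2real p))"

text \<open>The quantity \<open>E\<^sub>m\<^sub>,\<^sub>p(Re f)\<close>, as a function of \<open>f\<close>.\<close>

definition best_approx_Re :: "nat \<Rightarrow> ennreal \<Rightarrow> (complex \<Rightarrow> complex) \<Rightarrow> real" where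
  "best_approx_Re m p f =
     (INF P\<in>{P :: complex poly. degree P \<le> m}. hp_norm p (\<lambda>w. Re (f w - poly P w)))"

definition F :: "real \<Rightarrow> nat \<Rightarrow> real \<Rightarrow> real" where
  "F q n \<beta> = integral {0..pi} (\<lambda>v.
     \<bar>sin v powr (real (n + 1) - 2 / q)
       * cos (v * real (n + 1) + \<beta> - pi / 2 * (real n - 1))\<bar> powr q)"

text \<open>\<open>F\<^sub>q(\<beta>)\<^bsup>1/q\<^esup>\<close>, including its reading for \<open>q = \<infinity>\<close>.\<close>

definition F_root :: "ennreal \<Rightarrow> nat \<Rightarrow> real \<Rightarrow> real" where
  "F_root q n \<beta> =
     (if q = \<infinity> then
        (SUP v\<in>{0..pi}.
          \<bar>sin v ^ (n + 1) * cos (v * real (n + 1) + \<beta> - pi / 2 * (real n - 1))\<bar>)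
      else F (enn2real q) n \<beta> powr (1 / enn2real q))"

text \<open>The constant \<open>C\<^sub>p\<^sub>,\<^sub>n\<close>, as a function of the conjugate exponent \<open>q\<close> of \<open>p\<close>.\<close>

definition sharp_const :: "ennreal \<Rightarrow> nat \<Rightarrow> real" where
  "sharp_const q n =
     fact n / pi * 2 powr (real n + 1 - enn2real (1 / q)) * (SUP \<beta>\<in>{0..pi / 2}. F_root q n \<beta>)"

end

(* Let u = Re f. Adding the vanishing integral of cnj f to Cauchy's formula gives
   f^(n)(z) = n!/pi * int u(w) w / (w - z)^(n+1) dt over the circle, so the best constant at z is the
   L^q norm of w |-> Re(e^(i theta) w / (w - z)^(n+1)), maximised over theta. The Moebius substitution
   w |-> (w + z) / (1 + cnj z w) turns this norm into (1 - |z|^2)^(-n-1/p) times the L^q norm of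
     |1 + b w|^(2-2/q) Re(e^(i theta) w^(-n) (1 + b w)^(n-1)),   b = cnj z.
   The absolute value of this function is subharmonic in b, since rho^alpha |cos(m phi + c)| is
   subharmonic for alpha >= m. By the maximum principle its L^q norm is largest for |b| = 1, where it
   equals 2^(n+1-1/q) F_q(beta)^(1/q). Letting |z| -> 1, duality and the density of the real parts of
   polynomials on the circle show that nothing is lost. *)
theory Submission
  imports Defs "HOL-Complex_Analysis.Cauchy_Integral_Formula"
begin

section \<open>Integrals over the unit circle\<close>

text \<open>Where the exponents come from: the kernel transplanted by the Moebius map carries |1 + b
  w|^2, and the Jacobian to the power 1/q takes back 2/q. So the modulus has exponent alpha = (n -
  1) + (2 - 2/q) against the frequency m = n - 1, and alpha >= m says exactly q >= 1; for q = 1 the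
  function is the modulus of a harmonic one. Subharmonicity is used only for |b| < 1, where 1 + b w
  has no zero and a branch of its alpha-th power exists near each centre; the degenerate case |b| =
  1 enters through continuity alone. The maximum principle asks for one circle about each centre,
  but its radius must be common to all w, so that the inequality can be integrated in w.

  Re f is given only inside the disc. To stay among continuous functions on the circle, the upper
  bound is shown first for functions holomorphic beyond the closed disc and then transferred through
  the dilates f(r z). For sharpness no extremal function is exhibited: an admissible constant is
  tested against polynomials f, with zero as the approximating polynomial.\<close>

definition circle_int :: "(complex \<Rightarrow> 'a::euclidean_space) \<Rightarrow> 'a" where
  "circle_int g = integral {0..2 * pi} (\<lambda>t. g (cis t))"

lemma continuous_on_circle_param:
  assumes "continuous_on (sphere 0 1) g"
  shows "continuous_on A (\<lambda>t. g (cis (t + c)))"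
  by (rule continuous_on_compose2[OF assms]) (auto intro!: continuous_intros)

lemma circle_integrable:
  fixes g :: "complex \<Rightarrow> 'a::euclidean_space"
  assumes "continuous_on (sphere 0 1) g"
  shows "(\<lambda>t. g (cis t)) integrable_on {a..b}"
  using integrable_continuous_interval[OF continuous_on_circle_param[OF assms, of _ 0]] by simp

lemma has_integral_circle_int:
  assumes "continuous_on (sphere 0 1) g"
  shows "((\<lambda>t. g (cis t)) has_integral circle_int g) {0..2 * pi}"
  unfolding circle_int_def using circle_integrable[OF assms] by (rule integrable_integral)

lemma circle_int_cong: "(\<And>w. w \<in> sphere 0 1 \<Longrightarrow> f w = g w) \<Longrightarrow> circle_int f = circle_int g"
  unfolding circle_int_def by (intro integral_cong) auto

lemma circle_int_mono:
  fixes f g :: "complex \<Rightarrow> real"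
  assumes "continuous_on (sphere 0 1) f" "continuous_on (sphere 0 1) g"
    "\<And>w. w \<in> sphere 0 1 \<Longrightarrow> f w \<le> g w"
  shows "circle_int f \<le> circle_int g"
  unfolding circle_int_def using assms
  by (intro integral_le circle_integrable) auto

lemma circle_int_const: "circle_int (\<lambda>w. c) = (2 * pi) *\<^sub>R c"
  unfolding circle_int_def by simp

lemma circle_int_nonneg:
  fixes f :: "complex \<Rightarrow> real"
  assumes "continuous_on (sphere 0 1) f" "\<And>w. w \<in> sphere 0 1 \<Longrightarrow> 0 \<le> f w"
  shows "0 \<le> circle_int f"
  using circle_int_mono[of "\<lambda>_. 0" f] assms by (simp add: circle_int_const)

lemma circle_int_add:
  assumes "continuous_on (sphere 0 1) f" "continuous_on (sphere 0 1) g"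
  shows "circle_int (\<lambda>w. f w + g w) = circle_int f + circle_int g"
  unfolding circle_int_def using assms by (intro integral_add circle_integrable)

lemma circle_int_diff:
  assumes "continuous_on (sphere 0 1) f" "continuous_on (sphere 0 1) g"
  shows "circle_int (\<lambda>w. f w - g w) = circle_int f - circle_int g"
  unfolding circle_int_def using assms by (intro integral_diff circle_integrable)

lemma circle_int_cmult:
  fixes c :: real
  shows "circle_int (\<lambda>w. c * f w) = c * circle_int f"
  unfolding circle_int_def by simp

lemma circle_int_abs_le:
  fixes f :: "complex \<Rightarrow> real"
  assumes "continuous_on (sphere 0 1) f"
  shows "\<bar>circle_int f\<bar> \<le> circle_int (\<lambda>w. \<bar>f w\<bar>)"
  unfolding circle_int_def real_norm_def[symmetric]
  using assms by (intro integral_norm_bound_integral circle_integrable continuous_on_norm) auto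

lemma circle_int_eq_0D:
  fixes f :: "complex \<Rightarrow> real"
  assumes "continuous_on (sphere 0 1) f" "\<And>w. w \<in> sphere 0 1 \<Longrightarrow> 0 \<le> f w"
    "circle_int f = 0" "w \<in> sphere 0 1"
  shows "f w = 0"
proof -
  have "\<forall>t\<in>{0..2*pi}. f (cis t) = 0"
    using assms integral_eq_0_iff[of 0 "2*pi" "\<lambda>t. f (cis t)"]
      continuous_on_circle_param[OF assms(1), of _ 0]
    unfolding circle_int_def by auto
  moreover have "w = cis (Arg2pi w)"
    using Arg2pi_eq[of w] assms(4) by (simp add: cis_conv_exp)
  ultimately show ?thesis
    by (metis Arg2pi atLeastAtMost_iff less_imp_le)
qed

section \<open>Shifts, rotations and parameter integrals\<close>

lemma periodic_integral_shift:
  fixes h :: "real \<Rightarrow> 'a::euclidean_space"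
  assumes cont: "continuous_on UNIV h" and per: "\<And>t. h (t + 2 * pi) = h t"
  shows "integral {c..c + 2 * pi} h = integral {0..2 * pi} h"
proof -
  have int: "h integrable_on {a..b}" for a b
    using continuous_on_subset[OF cont] by (intro integrable_continuous_interval) auto
  have sh: "integral {a..b} h = integral {a + 2 * pi..b + 2 * pi} h" for a b
    using integral_shift[of a "2 * pi" b h] continuous_on_subset[OF cont] per by (simp add: o_def)
  have split: "integral {a..b} h + integral {b..c} h = integral {a..c} h" if "a \<le> b" "b \<le> c" for a b c
    using that int by (intro Henstock_Kurzweil_Integration.integral_combine) auto
  have pos: "integral {a..a + 2 * pi} h = integral {b..b + 2 * pi} h" if "a \<le> b" "b \<le> a + 2 * pi" for a b
    using split[of a b "a + 2*pi"] split[of b "a + 2*pi" "b + 2*pi"] sh[of a b] that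
    by (simp add: algebra_simps)
  have stp: "integral {a..a + 2 * pi} h = integral {a + 2 * pi..a + 2 * pi + 2 * pi} h" for a
    using sh[of a "a + 2*pi"] by simp
  have nat: "integral {a..a + 2 * pi} h = integral {a + 2 * pi * of_nat k..a + 2 * pi * of_nat k + 2 * pi} h" for a k
  proof (induction k)
    case (Suc k)
    then show ?case using stp[of "a + 2 * pi * of_nat k"] by (simp add: algebra_simps)
  qed simp
  have all: "integral {a..a + 2 * pi} h = integral {b..b + 2 * pi} h" if "a \<le> b" for a b
  proof -
    \<comment> \<open>Whole periods between \<open>a\<close> and \<open>b\<close> are removed by
      \<open>nat\<close>; the remaining shift is shorter than one period, as \<open>pos\<close>
      requires.\<close>
    define k where "k = nat \<lfloor>(b - a) / (2 * pi)\<rfloor>"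
    have "real k \<le> (b - a) / (2 * pi)" "(b - a) / (2 * pi) < real k + 1"
      using that unfolding k_def by (auto simp: le_nat_floor floor_less_iff)
    then have "a + 2 * pi * real k \<le> b" "b \<le> a + 2 * pi * real k + 2 * pi"
      by (auto simp: field_simps)
    then show ?thesis using pos nat by metis
  qed
  show ?thesis
    using all[of c 0] all[of 0 c] by (cases "c \<le> 0") auto
qed

lemma circle_int_shift:
  assumes "continuous_on (sphere 0 1) g"
  shows "integral {c..c + 2 * pi} (\<lambda>t. g (cis t)) = circle_int g"
  unfolding circle_int_def
  using continuous_on_circle_param[OF assms, of UNIV 0]
  by (intro periodic_integral_shift) (auto simp: cis_mult[symmetric])

lemma circle_int_rotate:
  fixes g :: "complex \<Rightarrow> 'a::euclidean_space"
  assumes "continuous_on (sphere 0 1) g" "b \<in> sphere 0 1"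
  shows "circle_int (\<lambda>w. g (b * w)) = circle_int g"
proof -
  define c where "c = Arg2pi b"
  have b: "b = cis c"
    using Arg2pi_eq[of b] assms(2) unfolding c_def by (simp add: cis_conv_exp)
  have "circle_int (\<lambda>w. g (b * w)) = integral {0..2*pi} ((\<lambda>t. g (cis t)) \<circ> (\<lambda>t. t + c))"
    unfolding circle_int_def b o_def by (simp add: cis_mult add.commute)
  also have "\<dots> = integral {0 + c..2 * pi + c} (\<lambda>t. g (cis t))"
    using continuous_on_circle_param[OF assms(1), of _ 0] by (intro integral_shift) auto
  also have "\<dots> = circle_int g"
    using circle_int_shift[OF assms(1), of c] by (simp add: add.commute)
  finally show ?thesis .
qed

lemma circle_int_continuous_on:
  fixes g :: "complex \<Rightarrow> complex \<Rightarrow> real"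
  assumes "continuous_on (S \<times> sphere 0 1) (\<lambda>(b, w). g b w)"
  shows "continuous_on S (\<lambda>b. circle_int (g b))"
proof -
  have "continuous_on (S \<times> cbox 0 (2*pi)) (\<lambda>(b, t). g b (cis t))"
    unfolding split_beta
    by (rule continuous_on_compose2[OF assms, where f = "\<lambda>x. (fst x, cis (snd x))", simplified split_beta fst_conv snd_conv])
      (auto intro!: continuous_intros)
  from integral_continuous_on_param[OF this] show ?thesis
    unfolding circle_int_def by simp
qed

lemma circle_int_swap:
  fixes g :: "complex \<Rightarrow> complex \<Rightarrow> real"
  assumes "continuous_on (sphere 0 1 \<times> sphere 0 1) (\<lambda>(b, w). g b w)"
  shows "circle_int (\<lambda>b. circle_int (g b)) = circle_int (\<lambda>w. circle_int (\<lambda>b. g b w))"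
proof -
  have "continuous_on (cbox (0, 0) (2*pi, 2*pi)) (\<lambda>(s, t). g (cis s) (cis t))"
    unfolding split_beta
    by (rule continuous_on_compose2[OF assms, where f = "\<lambda>x. (cis (fst x), cis (snd x))", simplified split_beta fst_conv snd_conv])
      (auto intro!: continuous_intros)
  from integral_swap_continuous[OF this] show ?thesis
    unfolding circle_int_def by simp
qed

section \<open>Norms on the circle and duality\<close>

lemma conjugate_exponents_cases [consumes 2, case_names one top mid]:
  fixes p q :: ennreal
  assumes "1 \<le> p" "1 / p + 1 / q = 1"
  obtains "p = 1" "q = \<infinity>" | "p = \<infinity>" "q = 1"
    | P Q :: real where "P > 1" "Q > 1" "p = ennreal P" "q = ennreal Q" "1 / P + 1 / Q = 1"
proof (cases p rule: ennreal_cases)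
  case (real P)
  then have P: "P \<ge> 1" using assms(1) by simp
  show ?thesis
  proof (cases q rule: ennreal_cases)
    case top
    then have "1 / ennreal P = 1" using assms(2) real by simp
    then have "P = 1" using P
      by (metis divide_ennreal ennreal_1 ennreal_eq_1 div_by_1 eq_divide_eq_1 le_numeral_extra(1) less_le_trans zero_less_one zero_le_one)
    then show ?thesis using that(1) real top by simp
  next
    case (real Q)
    \<comment> \<open>In \<open>ennreal\<close>, \<open>1 / 0 = \<infinity>\<close>, so
      \<open>q = 0\<close> would make the sum of the reciprocals infinite.\<close>
    have Q0: "Q > 0"
    proof (rule ccontr)
      assume "\<not> 0 < Q"
      then have "q = 0" using real by simp
      then show False using assms(2) by (simp add: ennreal_divide_zero)
    qed
    have "1 / ennreal P = ennreal (1 / P)" "1 / ennreal Q = ennreal (1 / Q)"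
      using divide_ennreal[of 1 P] divide_ennreal[of 1 Q] P Q0 by auto
    then have "ennreal (1 / P + 1 / Q) = ennreal 1"
      using assms(2) \<open>p = ennreal P\<close> \<open>q = ennreal Q\<close> P Q0 by simp
    then have eq: "1 / P + 1 / Q = 1" using P Q0 by (subst (asm) ennreal_inj) auto
    have "0 < 1 / P" "0 < 1 / Q" using P Q0 by auto
    then have "1 / P < 1" "1 / Q < 1" using eq by linarith+
    then have "P > 1" "Q > 1" using P Q0 by (auto simp: divide_less_eq)
    moreover note eq
    ultimately show ?thesis using that(3) real eq \<open>p = ennreal P\<close> by blast
  qed
next
  case top
  then have "1 / q = 1" using assms(2) by simp
  then have "q = 1"
  proof (cases q rule: ennreal_cases)
    case (real Q)
    have Q0: "Q > 0"
    proof (rule ccontr)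
      assume "\<not> 0 < Q"
      then have "q = 0" using real by simp
      then show False using \<open>1 / q = 1\<close> by (simp add: ennreal_divide_zero)
    qed
    then have "ennreal (1 / Q) = 1" using divide_ennreal[of 1 Q] \<open>1 / q = 1\<close> real by simp
    then show ?thesis using real Q0 by simp
  qed simp
  then show ?thesis using that(2) top by simp
qed

text \<open>The measure \<open>dt\<close> is left unnormalised to agree with \<open>hp_norm\<close>.
  A plain supremum replaces the essential one, since it is applied to continuous functions.\<close>

definition circle_norm :: "ennreal \<Rightarrow> (complex \<Rightarrow> real) \<Rightarrow> real" where
  "circle_norm p U =
     (if p = \<infinity> then (SUP w\<in>sphere 0 1. \<bar>U w\<bar>)
      else circle_int (\<lambda>w. \<bar>U w\<bar> powr enn2real p) powr (1 / enn2real p))"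

lemma circle_norm_top: "circle_norm \<infinity> U = (SUP w\<in>sphere 0 1. \<bar>U w\<bar>)"
  by (simp add: circle_norm_def)

lemma circle_norm_real:
  "0 \<le> P \<Longrightarrow> circle_norm (ennreal P) U = circle_int (\<lambda>w. \<bar>U w\<bar> powr P) powr (1 / P)"
  by (simp add: circle_norm_def)

lemma circle_bdd:
  fixes U :: "complex \<Rightarrow> real"
  assumes "continuous_on (sphere 0 1) U"
  shows "bdd_above ((\<lambda>w. \<bar>U w\<bar>) ` sphere 0 1)"
  by (intro bounded_imp_bdd_above compact_imp_bounded compact_continuous_image
      continuous_intros assms compact_sphere)

lemma abs_le_circle_norm_top:
  assumes "continuous_on (sphere 0 1) U" "w \<in> sphere 0 1"
  shows "\<bar>U w\<bar> \<le> circle_norm \<infinity> U"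
  unfolding circle_norm_top using circle_bdd[OF assms(1)] assms(2) by (intro cSUP_upper) auto

lemma circle_norm_top_le:
  assumes "\<And>w. w \<in> sphere 0 1 \<Longrightarrow> \<bar>U w\<bar> \<le> M"
  shows "circle_norm \<infinity> U \<le> M"
  unfolding circle_norm_top using assms by (intro cSUP_least) auto

lemma circle_norm_nonneg:
  assumes "continuous_on (sphere 0 1) U"
  shows "0 \<le> circle_norm p U"
proof (cases "p = \<infinity>")
  case True
  then show ?thesis using abs_le_circle_norm_top[OF assms, of 1] by simp
qed (simp add: circle_norm_def)

lemma circle_norm_cong:
  "(\<And>w. w \<in> sphere 0 1 \<Longrightarrow> \<bar>U w\<bar> = \<bar>V w\<bar>) \<Longrightarrow> circle_norm p U = circle_norm p V"
  unfolding circle_norm_def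
  by (auto intro!: SUP_cong arg_cong[where f = "\<lambda>x. x powr _"] circle_int_cong)

lemma continuous_on_abs_powr:
  fixes U :: "'a::topological_space \<Rightarrow> real"
  assumes "continuous_on S U" "P > 0"
  shows "continuous_on S (\<lambda>w. \<bar>U w\<bar> powr P)"
  using assms by (intro continuous_on_powr' continuous_intros) auto

text \<open>For finite exponents, Young's inequality is integrated after both functions have been
  scaled to norm one. At the endpoints the supremum is pulled out of the integral.\<close>

lemma circle_hoelder:
  assumes pq: "1 \<le> p" "1 / p + 1 / q = 1"
    and U: "continuous_on (sphere 0 1) U" and V: "continuous_on (sphere 0 1) V"
  shows "\<bar>circle_int (\<lambda>w. U w * V w)\<bar> \<le> circle_norm p U * circle_norm q V"
proof -
  have endpoint: "circle_int (\<lambda>w. \<bar>U w\<bar> * \<bar>V w\<bar>) \<le> circle_norm 1 U * circle_norm \<infinity> V"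
    if U: "continuous_on (sphere 0 1) U" and V: "continuous_on (sphere 0 1) V" for U V
  proof -
    have "circle_int (\<lambda>w. \<bar>U w\<bar> * \<bar>V w\<bar>) \<le> circle_int (\<lambda>w. circle_norm \<infinity> V * \<bar>U w\<bar>)"
      unfolding mult.commute[of "circle_norm \<infinity> V"]
      by (intro circle_int_mono continuous_intros U V mult_left_mono abs_le_circle_norm_top) auto
    also have "\<dots> = circle_norm \<infinity> V * circle_int (\<lambda>w. \<bar>U w\<bar>)"
      by (rule circle_int_cmult)
    also have "circle_int (\<lambda>w. \<bar>U w\<bar>) = circle_norm 1 U"
      using circle_norm_real[of 1 U] circle_int_nonneg[of "\<lambda>w. \<bar>U w\<bar>"] U
      by (simp add: continuous_on_rabs)
    finally show ?thesis by (simp only: mult.commute)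
  qed
  have "circle_int (\<lambda>w. \<bar>U w\<bar> * \<bar>V w\<bar>) \<le> circle_norm p U * circle_norm q V"
    using pq
  proof (cases rule: conjugate_exponents_cases)
    case one
    then show ?thesis using endpoint[OF U V] by simp
  next
    case top
    then show ?thesis using endpoint[OF V U] by (simp add: mult.commute)
  next
    case (mid P Q)
    let ?a = "circle_int (\<lambda>w. \<bar>U w\<bar> powr P)" and ?b = "circle_int (\<lambda>w. \<bar>V w\<bar> powr Q)"
    note cU = continuous_on_abs_powr[OF U, of P] and cV = continuous_on_abs_powr[OF V, of Q]
    define a where "a = ?a powr (1 / P)"
    define b where "b = ?b powr (1 / Q)"
    have nn: "?a \<ge> 0" "?b \<ge> 0" using mid cU cV by (auto intro!: circle_int_nonneg)
    have norms: "circle_norm p U = a" "circle_norm q V = b"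
      using mid by (auto simp: circle_norm_real a_def b_def)
    show ?thesis
    proof (cases "?a = 0 \<or> ?b = 0")
      \<comment> \<open>A zero norm cannot be scaled to one; by continuity the corresponding
        function then vanishes at every point of the circle.\<close>
      case True
      then have "\<bar>U w\<bar> * \<bar>V w\<bar> = 0" if "w \<in> sphere 0 1" for w
        using circle_int_eq_0D[OF cU _ _ that] circle_int_eq_0D[OF cV _ _ that] mid by auto
      then have "circle_int (\<lambda>w. \<bar>U w\<bar> * \<bar>V w\<bar>) = circle_int (\<lambda>w. 0 :: real)"
        by (intro circle_int_cong) auto
      then show ?thesis using norms by (simp add: circle_int_const a_def b_def)
    next
      case False
      then have ab: "a > 0" "b > 0" using nn by (auto simp: a_def b_def)
      have aP: "a powr P = ?a" "b powr Q = ?b"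
        using nn mid by (auto simp: a_def b_def powr_powr)
      have "circle_int (\<lambda>w. \<bar>U w\<bar> * \<bar>V w\<bar>) / (a * b)
            = circle_int (\<lambda>w. inverse (a * b) * (\<bar>U w\<bar> * \<bar>V w\<bar>))"
        by (subst circle_int_cmult) (simp add: field_simps)
      also have "\<dots> \<le> circle_int (\<lambda>w. inverse (P * ?a) * \<bar>U w\<bar> powr P + inverse (Q * ?b) * \<bar>V w\<bar> powr Q)"
      proof (intro circle_int_mono continuous_on_add continuous_on_mult continuous_on_const continuous_on_rabs U V cU cV)
        fix w
        have "(\<bar>U w\<bar> / a) * (\<bar>V w\<bar> / b) \<le> (\<bar>U w\<bar> / a) powr P / P + (\<bar>V w\<bar> / b) powr Q / Q"
          using mid ab by (intro Youngs_inequality) auto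
        then show "inverse (a * b) * (\<bar>U w\<bar> * \<bar>V w\<bar>)
            \<le> inverse (P * ?a) * \<bar>U w\<bar> powr P + inverse (Q * ?b) * \<bar>V w\<bar> powr Q"
          using ab aP by (simp add: powr_divide field_simps)
      qed (use mid in auto)
      also have "\<dots> = inverse (P * ?a) * ?a + inverse (Q * ?b) * ?b"
        using mid by (subst circle_int_add) (auto simp: circle_int_cmult intro!: continuous_on_mult continuous_on_const cU cV)
      also have "\<dots> = 1" using False mid by (simp add: field_simps)
      finally show ?thesis using ab norms by (simp add: field_simps)
    qed
  qed
  moreover have "\<bar>circle_int (\<lambda>w. U w * V w)\<bar> \<le> circle_int (\<lambda>w. \<bar>U w\<bar> * \<bar>V w\<bar>)"
    using circle_int_abs_le[of "\<lambda>w. U w * V w"] by (simp add: abs_mult continuous_on_mult U V)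
  ultimately show ?thesis by linarith
qed

lemma tendsto_of_abs_le:
  fixes x :: "nat \<Rightarrow> real"
  assumes "\<And>j. \<bar>x j - L\<bar> \<le> 1 / real (Suc j)"
  shows "x \<longlonglongrightarrow> L"
  using assms
  by (intro LIM_zero_cancel[OF Lim_null_comparison[OF _ LIMSEQ_inverse_real_of_nat]] always_eventually)
    (auto simp: inverse_eq_divide)

text \<open>Carries an inequality from real parts of polynomials to all continuous functions in the
  duality argument. The explicit rate, at most \<open>1\<close>, provides the constant majorant for
  dominated convergence.\<close>

lemma circle_norm_tendsto:
  assumes U: "\<And>j. continuous_on (sphere 0 1) (U j)" "continuous_on (sphere 0 1) V" and p: "1 \<le> p"
    and le: "\<And>j w. w \<in> sphere 0 1 \<Longrightarrow> \<bar>U j w - V w\<bar> \<le> 1 / real (Suc j)"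
  shows "(\<lambda>j. circle_norm p (U j)) \<longlonglongrightarrow> circle_norm p V"
proof (cases p rule: ennreal_cases)
  case (real P)
  then have P: "P \<ge> 1" using p by simp
  have conv: "(\<lambda>j. U j w) \<longlonglongrightarrow> V w" if "w \<in> sphere 0 1" for w
    using le[OF that] by (rule tendsto_of_abs_le)
  define M where "M = circle_norm \<infinity> V + 1"
  have "(\<lambda>j. integral {0..2*pi} (\<lambda>t. \<bar>U j (cis t)\<bar> powr P)) \<longlonglongrightarrow> integral {0..2*pi} (\<lambda>t. \<bar>V (cis t)\<bar> powr P)"
  proof (rule dominated_convergence(2))
    show "(\<lambda>t. \<bar>U j (cis t)\<bar> powr P) integrable_on {0..2*pi}" for j
      using P U by (intro circle_integrable continuous_on_abs_powr) auto
    show "(\<lambda>t. M powr P) integrable_on {0..2*pi}" by (rule integrable_const_ivl)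
    fix j t
    have "\<bar>U j (cis t) - V (cis t)\<bar> \<le> 1"
      by (rule order.trans[OF le]) auto
    then have "\<bar>U j (cis t)\<bar> \<le> M"
      using abs_le_circle_norm_top[OF U(2), of "cis t"] unfolding M_def by auto
    then show "norm (\<bar>U j (cis t)\<bar> powr P) \<le> M powr P"
      using P by (auto intro!: powr_mono2)
  next
    fix t
    show "(\<lambda>j. \<bar>U j (cis t)\<bar> powr P) \<longlonglongrightarrow> \<bar>V (cis t)\<bar> powr P"
      using P by (intro tendsto_powr' tendsto_intros conv) auto
  qed
  then have "(\<lambda>j. circle_int (\<lambda>w. \<bar>U j w\<bar> powr P)) \<longlonglongrightarrow> circle_int (\<lambda>w. \<bar>V w\<bar> powr P)"
    unfolding circle_int_def .
  then show ?thesis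
    using real P
    by (auto simp: circle_norm_real intro!: tendsto_powr' circle_int_nonneg continuous_on_abs_powr U always_eventually)
next
  case top
  have "\<bar>circle_norm \<infinity> (U j) - circle_norm \<infinity> V\<bar> \<le> 1 / real (Suc j)" for j
  proof -
    have "circle_norm \<infinity> (U j) \<le> circle_norm \<infinity> V + 1 / real (Suc j)"
    proof (rule circle_norm_top_le)
      fix w :: complex assume "w \<in> sphere 0 1"
      then show "\<bar>U j w\<bar> \<le> circle_norm \<infinity> V + 1 / real (Suc j)"
        using le[of w j] abs_le_circle_norm_top[OF U(2), of w] by auto
    qed
    moreover have "circle_norm \<infinity> V \<le> circle_norm \<infinity> (U j) + 1 / real (Suc j)"
    proof (rule circle_norm_top_le)
      fix w :: complex assume "w \<in> sphere 0 1"
      then show "\<bar>V w\<bar> \<le> circle_norm \<infinity> (U j) + 1 / real (Suc j)"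
        using le[of w j] abs_le_circle_norm_top[OF U(1), of w j] by auto
    qed
    ultimately show ?thesis by auto
  qed
  then show ?thesis unfolding top infinity_ennreal_def by (rule tendsto_of_abs_le)
qed

text \<open>The converse of Hoelder's inequality. Each case picks a test function at or near
  equality in Hoelder that is still continuous, since \<open>K\<close> is tested against continuous
  functions.\<close>

lemma circle_norm_le_dual:
  assumes pq: "1 \<le> p" "1 / p + 1 / q = 1"
    and k: "continuous_on (sphere 0 1) k"
    and K: "\<And>U. continuous_on (sphere 0 1) U \<Longrightarrow> circle_int (\<lambda>w. U w * k w) \<le> K * circle_norm p U"
  shows "circle_norm q k \<le> K"
  using pq
proof (cases rule: conjugate_exponents_cases)
  case one
  have norm1: "circle_norm p U = circle_int (\<lambda>w. \<bar>U w\<bar>)" if "continuous_on (sphere 0 1) U" for U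
    using circle_norm_real[of 1 U] circle_int_nonneg[of "\<lambda>w. \<bar>U w\<bar>"] that one
    by (simp add: continuous_on_rabs)
  \<comment> \<open>Testing with \<open>1\<close> and \<open>-1\<close> bounds
    \<open>circle_int k\<close> and its negative by the same multiple of \<open>K\<close>, which is
    therefore nonnegative.\<close>
  have "0 \<le> K * (2 * pi)"
    using K[of "\<lambda>_. 1"] K[of "\<lambda>_. -1"] circle_int_cmult[of "-1" k]
    by (simp add: norm1 circle_int_const)
  then have "0 \<le> K" using mult_le_cancel_right_pos[of "2 * pi" 0 K] by simp
  have le: "\<bar>k w\<bar> \<le> c" if "c > K" "w \<in> sphere 0 1" for c w
  proof -
    \<comment> \<open>Soft thresholding of \<open>k\<close> at a level \<open>c > K\<close>. As
      \<open>U\<close> lives where \<open>\<bar>k w\<bar> > c\<close>, the integral of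
      \<open>c * \<bar>U w\<bar>\<close> is at most that of \<open>K * \<bar>U w\<bar>\<close>, so
      \<open>U\<close> vanishes.\<close>
    define U where "U w = max 0 (k w - c) - max 0 (- k w - c)" for w
    have cU: "continuous_on (sphere 0 1) U" unfolding U_def by (intro continuous_intros k)
    have c0: "c > 0" using that \<open>0 \<le> K\<close> by simp
    have "circle_int (\<lambda>w. c * \<bar>U w\<bar>) \<le> circle_int (\<lambda>w. U w * k w)"
    proof (intro circle_int_mono continuous_intros cU k)
      fix w
      show "c * \<bar>U w\<bar> \<le> U w * k w"
      proof (cases "\<bar>k w\<bar> \<le> c")
        case True then show ?thesis using c0 by (simp add: U_def)
      next
        case False
        have "U w * k w = \<bar>U w\<bar> * \<bar>k w\<bar>" using False c0 by (cases "k w \<ge> 0") (auto simp: U_def algebra_simps)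
        then show ?thesis using False mult_left_mono[of c "\<bar>k w\<bar>" "\<bar>U w\<bar>"] by (simp add: mult.commute)
      qed
    qed
    also have "\<dots> \<le> K * circle_int (\<lambda>w. \<bar>U w\<bar>)" using K[OF cU] norm1[OF cU] by simp
    finally have "(c - K) * circle_int (\<lambda>w. \<bar>U w\<bar>) \<le> 0" by (simp add: circle_int_cmult algebra_simps)
    moreover have nn: "0 \<le> circle_int (\<lambda>w. \<bar>U w\<bar>)"
      by (intro circle_int_nonneg continuous_intros cU) auto
    ultimately have "circle_int (\<lambda>w. \<bar>U w\<bar>) = 0"
      using that(1) by (simp add: mult_le_0_iff)
    then have "\<bar>U w\<bar> = 0"
      using circle_int_eq_0D[of "\<lambda>w. \<bar>U w\<bar>" w] that(2) cU by (auto intro!: continuous_intros)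
    then show ?thesis using c0 by (auto simp: U_def max_def split: if_splits)
  qed
  have "\<bar>k w\<bar> \<le> K" if "w \<in> sphere 0 1" for w
    using le[OF _ that] by (rule dense_ge)
  then have "circle_norm \<infinity> k \<le> K" by (rule circle_norm_top_le)
  then show ?thesis using one by simp
next
  case top
  define A where "A = circle_int (\<lambda>w. \<bar>k w\<bar>)"
  have ck: "continuous_on (sphere 0 1) (\<lambda>w. \<bar>k w\<bar>)" by (intro continuous_intros k)
  have le: "A \<le> K + 2 * pi * d" if "d > 0" for d
  proof -
    \<comment> \<open>A continuous substitute for \<open>sgn (k w)\<close>; it loses at most
      \<open>d\<close> pointwise, and \<open>d\<close> is sent to \<open>0\<close>.\<close>
    define U where "U w = k w / (\<bar>k w\<bar> + d)" for w
    have cU: "continuous_on (sphere 0 1) U"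
      unfolding U_def using that by (intro continuous_intros k) (smt (verit) abs_ge_zero)
    have "A - 2 * pi * d = circle_int (\<lambda>w. \<bar>k w\<bar> - d)"
      using circle_int_diff[OF ck, of "\<lambda>_. d"] by (simp add: A_def circle_int_const)
    also have "\<dots> \<le> circle_int (\<lambda>w. U w * k w)"
    proof (intro circle_int_mono continuous_intros cU k)
      fix w
      have "(\<bar>k w\<bar> - d) * (\<bar>k w\<bar> + d) \<le> k w * k w"
        by (simp add: algebra_simps abs_mult_self_eq)
      then show "\<bar>k w\<bar> - d \<le> U w * k w"
        using that by (simp add: U_def pos_le_divide_eq add_nonneg_pos)
    qed
    also have "\<dots> \<le> K * circle_norm p U" using K[OF cU] .
    finally have 1: "A - 2 * pi * d \<le> K * circle_norm p U" .
    have "circle_norm \<infinity> U \<le> 1"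
      by (rule circle_norm_top_le) (use that in \<open>auto simp: U_def\<close>)
    then have "circle_norm p U \<le> 1" using top by simp
    moreover have "0 \<le> K"
    proof -
      have "circle_norm \<infinity> (\<lambda>_. 1) = 1" "circle_norm \<infinity> (\<lambda>_. -1) = 1"
        by (simp_all only: circle_norm_top) simp_all
      then show ?thesis
        using K[of "\<lambda>_. 1"] K[of "\<lambda>_. -1"] circle_int_cmult[of "-1" k] top by simp
    qed
    ultimately show ?thesis using 1 mult_left_le[of "circle_norm p U" K] by linarith
  qed
  have "A \<le> K"
  proof (rule field_le_epsilon)
    fix e :: real assume "e > 0"
    then show "A \<le> K + e" using le[of "e / (2 * pi)"] by simp
  qed
  moreover have "circle_norm q k = A"
    using top circle_norm_real[of 1 k] circle_int_nonneg[OF ck] by (simp add: A_def)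
  ultimately show ?thesis by simp
next
  case (mid P Q)
  define A where "A = circle_int (\<lambda>w. \<bar>k w\<bar> powr Q)"
  \<comment> \<open>The equality case of Hoelder: \<open>(Q - 1) * P = Q\<close> makes both
    \<open>\<bar>U w\<bar> powr P\<close> and \<open>U w * k w\<close> equal to
    \<open>\<bar>k w\<bar> powr Q\<close>.\<close>
  define U where "U w = sgn (k w) * \<bar>k w\<bar> powr (Q - 1)" for w
  have "A \<ge> 0" unfolding A_def using mid by (intro circle_int_nonneg continuous_on_abs_powr k) auto
  \<comment> \<open>Free of \<open>sgn\<close>, this form shows continuity at the zeros of
    \<open>k\<close>, as \<open>Q - 1 > 0\<close>.\<close>
  have U_alt: "U w = max 0 (k w) powr (Q - 1) - max 0 (- k w) powr (Q - 1)" for w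
    using mid by (auto simp: U_def sgn_if max_def)
  have cU: "continuous_on (sphere 0 1) U"
    unfolding U_alt using mid by (intro continuous_on_powr' continuous_intros k) auto
  have Q: "(Q - 1) * P = Q" using mid by (simp add: field_simps)
  have eq1: "circle_int (\<lambda>w. U w * k w) = A"
    unfolding A_def
  proof (rule circle_int_cong)
    fix w
    have "U w * k w = \<bar>k w\<bar> * \<bar>k w\<bar> powr (Q - 1)"
      by (simp add: U_def abs_sgn mult_ac)
    then show "U w * k w = \<bar>k w\<bar> powr Q" by (simp add: powr_mult_base)
  qed
  have "circle_int (\<lambda>w. \<bar>U w\<bar> powr P) = A"
    unfolding A_def using mid
    by (intro circle_int_cong) (auto simp: U_def abs_mult abs_sgn_eq powr_powr Q)
  then have eq2: "circle_norm p U = A powr (1 / P)" using mid by (simp add: circle_norm_real)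
  have "circle_norm q k = A powr (1 / Q)" using mid by (simp add: circle_norm_real A_def)
  also have "\<dots> \<le> K"
  proof (cases "A = 0")
    \<comment> \<open>Division by \<open>A powr (1 / P)\<close> is impossible here; the test
      function \<open>1\<close> supplies \<open>0 \<le> K\<close> instead.\<close>
    case True
    have "\<bar>k w\<bar> powr Q = 0" if "w \<in> sphere 0 1" for w
      using circle_int_eq_0D[OF continuous_on_abs_powr[OF k] _ _ that, of Q] True mid unfolding A_def by auto
    then have "k w = 0" if "w \<in> sphere 0 1" for w using that by simp
    then have "circle_int (\<lambda>w. 1 * k w) = circle_int (\<lambda>w. 0 :: real)"
      by (intro circle_int_cong) auto
    then have "0 \<le> K * circle_norm p (\<lambda>_. 1)"
      using K[of "\<lambda>_. 1"] by (simp add: circle_int_const)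
    moreover have "circle_norm p (\<lambda>_. 1) > 0"
      using mid by (simp add: circle_norm_real circle_int_const)
    ultimately show ?thesis using True by (simp add: zero_le_mult_iff)
  next
    case False
    then have "A > 0" using \<open>A \<ge> 0\<close> by simp
    have "A powr (1 / Q) * A powr (1 / P) = A"
      using mid \<open>A > 0\<close> by (simp add: powr_add[symmetric] add.commute)
    then have "A powr (1 / Q) * A powr (1 / P) \<le> K * A powr (1 / P)"
      using K[OF cU] eq1 eq2 by simp
    then show ?thesis using \<open>A > 0\<close> by simp
  qed
  finally show ?thesis .
qed

section \<open>A maximum principle\<close>

text \<open>Among the maximum points take one farthest from the origin. If it were interior, the
  sub-mean inequality would make a whole circle about it consist of maximum points, one of which
  lies farther out.\<close>

lemma max_principle_disc:
  fixes \<phi> :: "complex \<Rightarrow> real"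
  assumes cont: "continuous_on (cball 0 1) \<phi>"
    and sub: "\<And>a. a \<in> ball 0 1 \<Longrightarrow> \<exists>\<epsilon>>0. \<epsilon> < 1 - cmod a \<and>
                2 * pi * \<phi> a \<le> circle_int (\<lambda>v. \<phi> (a + of_real \<epsilon> * v))"
    and bd: "\<And>b. b \<in> sphere 0 1 \<Longrightarrow> \<phi> b \<le> M"
    and a: "a \<in> cball 0 1"
  shows "\<phi> a \<le> M"
proof -
  obtain x where x: "x \<in> cball 0 1" "\<And>y. y \<in> cball 0 1 \<Longrightarrow> \<phi> y \<le> \<phi> x"
    using continuous_attains_sup[OF _ _ cont] by auto
  define S where "S = {y \<in> cball 0 1. \<phi> y = \<phi> x}"
  have "closed S" unfolding S_def by (rule continuous_closed_preimage_constant[OF cont]) auto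
  then have "compact S" unfolding S_def
    by (metis (no_types, lifting) S_def bounded_cball bounded_subset compact_eq_bounded_closed mem_Collect_eq subsetI)
  moreover have "S \<noteq> {}" using x(1) by (auto simp: S_def)
  ultimately obtain b where b: "b \<in> S" "\<And>y. y \<in> S \<Longrightarrow> cmod y \<le> cmod b"
    using continuous_attains_sup[of S cmod] by (auto intro: continuous_intros)
  have "cmod b = 1"
  proof (rule ccontr)
    assume "cmod b \<noteq> 1"
    then have "b \<in> ball 0 1" using b(1) by (auto simp: S_def)
    then obtain e where e: "e > 0" "e < 1 - cmod b"
      "2 * pi * \<phi> b \<le> circle_int (\<lambda>v. \<phi> (b + of_real e * v))"
      using sub by blast
    have in_disc: "b + of_real e * v \<in> cball 0 1" if "v \<in> sphere 0 1" for v
    proof -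
      have "cmod (b + of_real e * v) \<le> cmod b + cmod (of_real e * v)" by (rule norm_triangle_ineq)
      then show ?thesis using that e by (simp add: norm_mult)
    qed
    have cd: "continuous_on (sphere 0 1) (\<lambda>v. \<phi> (b + of_real e * v))"
      by (rule continuous_on_compose2[OF cont]) (use in_disc in \<open>auto intro!: continuous_intros\<close>)
    have cd2: "continuous_on (sphere 0 1) (\<lambda>v. \<phi> x - \<phi> (b + of_real e * v))"
      by (intro continuous_intros cd)
    have nn: "0 \<le> \<phi> x - \<phi> (b + of_real e * v)" if "v \<in> sphere 0 1" for v
      using x(2) in_disc[OF that] by auto
    have "\<phi> b = \<phi> x" using b by (simp add: S_def)
    then have "circle_int (\<lambda>v. \<phi> x - \<phi> (b + of_real e * v)) \<le> 0"
      using e(3) circle_int_diff[OF _ cd, of "\<lambda>_. \<phi> x"] by (simp add: circle_int_const)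
    then have "circle_int (\<lambda>v. \<phi> x - \<phi> (b + of_real e * v)) = 0"
      using circle_int_nonneg[OF cd2 nn] by linarith
    then have eq: "\<phi> (b + of_real e * v) = \<phi> x" if "v \<in> sphere 0 1" for v
      using circle_int_eq_0D[OF cd2 nn _ that] by simp
    \<comment> \<open>The radial direction, in which the distance from the origin grows by exactly
      \<open>e\<close>; for \<open>b = 0\<close> any direction serves.\<close>
    define v where "v = cis (Arg b)"
    have "b + of_real e * v = of_real (cmod b + e) * v"
      using rcis_cmod_Arg[of b] by (simp add: rcis_def v_def algebra_simps)
    then have "cmod (b + of_real e * v) = cmod b + e"
      using e(1) by (simp add: norm_mult v_def del: of_real_add)
    moreover have "b + of_real e * v \<in> S"
      using eq[of v] in_disc[of v] by (auto simp: S_def v_def)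
    ultimately show False using b(2)[of "b + of_real e * v"] e(1) by simp
  qed
  then have "\<phi> x \<le> M" using bd[of b] b(1) by (simp add: S_def)
  then show ?thesis using x(2)[OF a] by simp
qed

text \<open>The graph of the convex function \<open>x powr q\<close> lies above its tangent at
  \<open>B\<close>. Young's inequality with exponents \<open>q\<close> and
  \<open>q / (q - 1)\<close> gives this, including the case \<open>B = 0\<close>.\<close>

lemma powr_tangent_le:
  fixes x B q :: real
  assumes "x \<ge> 0" "B \<ge> 0" "q \<ge> 1"
  shows "q * B powr (q - 1) * x \<le> x powr q + (q - 1) * B powr q"
proof (cases "q = 1")
  case True
  then show ?thesis using assms by simp
next
  case False
  define r where "r = q / (q - 1)"
  have r: "r > 1" "1 / q + 1 / r = 1" "(q - 1) * r = q"
    using assms False by (auto simp: r_def field_simps)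
  have "x * B powr (q - 1) \<le> x powr q / q + (B powr (q - 1)) powr r / r"
    using assms False r by (intro Youngs_inequality) auto
  also have "(B powr (q - 1)) powr r / r = B powr q * (q - 1) / q"
    using r(3) by (simp add: powr_powr) (simp add: r_def)
  finally show ?thesis using assms by (simp add: field_simps)
qed

text \<open>Jensen's inequality, obtained by integrating the tangent at \<open>B\<close>. Here
  \<open>B\<close> is a lower bound of the mean, as a sub-mean inequality provides.\<close>

lemma circle_int_powr_mean:
  assumes c: "continuous_on (sphere 0 1) \<psi>" and nn: "\<And>w. w \<in> sphere 0 1 \<Longrightarrow> 0 \<le> \<psi> w"
    and B: "0 \<le> B" "1 \<le> q" and le: "2 * pi * B \<le> circle_int \<psi>"
  shows "2 * pi * B powr q \<le> circle_int (\<lambda>w. \<psi> w powr q)"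
proof -
  have "continuous_on (sphere 0 1) (\<lambda>w. \<bar>\<psi> w\<bar> powr q)"
    using c B by (intro continuous_on_abs_powr) auto
  then have cp: "continuous_on (sphere 0 1) (\<lambda>w. \<psi> w powr q)"
    by (rule continuous_on_eq) (use nn in auto)
  have "q * B powr (q - 1) * (2 * pi * B) - (q - 1) * B powr q * (2 * pi)
      \<le> q * B powr (q - 1) * circle_int \<psi> - (q - 1) * B powr q * (2 * pi)"
    using le B by (intro diff_right_mono mult_left_mono) auto
  also have "\<dots> = circle_int (\<lambda>w. q * B powr (q - 1) * \<psi> w - (q - 1) * B powr q)"
    using c by (subst circle_int_diff) (auto simp: circle_int_cmult circle_int_const intro!: continuous_on_mult)
  also have "\<dots> \<le> circle_int (\<lambda>w. \<psi> w powr q)"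
    using powr_tangent_le[OF nn B] c cp
    by (intro circle_int_mono continuous_on_diff continuous_on_mult continuous_on_const) (auto simp: algebra_simps)
  also have "q * B powr (q - 1) * (2 * pi * B) = 2 * pi * q * B powr q"
    using powr_mult_base[of B "q - 1"] B by (simp add: algebra_simps)
  finally show ?thesis by (simp add: algebra_simps)
qed

text \<open>Since the radius in \<open>sub\<close> is common to all \<open>w\<close>, the sub-mean
  inequality can be raised to the power \<open>q\<close> by Jensen and integrated over
  \<open>w\<close>; swapping the integrals gives it for the \<open>q\<close>-th power of the norm.
  For \<open>q = \<infinity>\<close> the maximum principle is applied to each \<open>w\<close>
  separately.\<close>

lemma circle_norm_max_principle:
  fixes G :: "complex \<Rightarrow> complex \<Rightarrow> real"
  assumes cont: "continuous_on (cball 0 1 \<times> sphere 0 1) (\<lambda>(b, w). G b w)"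
    and sub: "\<And>a. a \<in> ball 0 1 \<Longrightarrow> \<exists>\<epsilon>>0. \<epsilon> < 1 - cmod a \<and>
       (\<forall>w\<in>sphere 0 1. 2 * pi * \<bar>G a w\<bar> \<le> circle_int (\<lambda>v. \<bar>G (a + of_real \<epsilon> * v) w\<bar>))"
    and bd: "\<And>b. b \<in> sphere 0 1 \<Longrightarrow> circle_norm q (G b) \<le> M"
    and q: "1 \<le> q" and b: "b \<in> cball 0 1"
  shows "circle_norm q (G b) \<le> M"
proof -
  have cb: "continuous_on (cball 0 1) (\<lambda>b. G b w)" if "w \<in> sphere 0 1" for w
    by (rule continuous_on_compose2[OF cont, where f = "\<lambda>b. (b, w)", simplified])
      (use that in \<open>auto intro!: continuous_intros\<close>)
  have cw: "continuous_on (sphere 0 1) (G b)" if "b \<in> cball 0 1" for b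
    by (rule continuous_on_compose2[OF cont, where f = "\<lambda>w. (b, w)", simplified])
      (use that in \<open>auto intro!: continuous_intros\<close>)
  have in_disc: "a + of_real e * v \<in> cball 0 1"
    if "e > 0" "e < 1 - cmod a" "v \<in> sphere 0 1" for a v :: complex and e
  proof -
    have "cmod (a + of_real e * v) \<le> cmod a + cmod (of_real e * v)" by (rule norm_triangle_ineq)
    then show ?thesis using that by (simp add: norm_mult)
  qed
  show ?thesis
  proof (cases q rule: ennreal_cases)
    case top
    show ?thesis unfolding top infinity_ennreal_def[symmetric]
    proof (rule circle_norm_top_le)
      fix w :: complex assume w: "w \<in> sphere 0 1"
      show "\<bar>G b w\<bar> \<le> M"
      proof (rule max_principle_disc[of "\<lambda>b. \<bar>G b w\<bar>"])
        show "continuous_on (cball 0 1) (\<lambda>b. \<bar>G b w\<bar>)" by (intro continuous_intros cb w)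
        show "\<bar>G b w\<bar> \<le> M" if "b \<in> sphere 0 1" for b
        proof -
          have "continuous_on (sphere 0 1) (G b)" using that by (intro cw) auto
          then show ?thesis using abs_le_circle_norm_top[of "G b" w] bd[OF that] w top by simp
        qed
        show "\<exists>\<epsilon>>0. \<epsilon> < 1 - cmod a \<and> 2 * pi * \<bar>G a w\<bar> \<le> circle_int (\<lambda>v. \<bar>G (a + of_real \<epsilon> * v) w\<bar>)"
          if "a \<in> ball 0 1" for a
          using sub[OF that] w by blast
      qed (rule b)
    qed
  next
    case (real Q)
    then have Q: "Q \<ge> 1" using q by simp
    have cQ: "continuous_on (cball 0 1 \<times> sphere 0 1) (\<lambda>(b, w). \<bar>G b w\<bar> powr Q)"
      using continuous_on_abs_powr[OF cont, of Q] Q by (simp add: split_beta)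
    have cQw: "continuous_on (sphere 0 1) (\<lambda>w. \<bar>G b w\<bar> powr Q)" if "b \<in> cball 0 1" for b
      using Q cw[OF that] by (intro continuous_on_abs_powr) auto
    define \<phi> where "\<phi> b = circle_int (\<lambda>w. \<bar>G b w\<bar> powr Q)" for b
    have norm: "circle_norm q (G b) = \<phi> b powr (1 / Q)" for b
      using real by (simp add: circle_norm_real \<phi>_def)
    have nn: "\<phi> b \<ge> 0" if "b \<in> cball 0 1" for b
      unfolding \<phi>_def by (intro circle_int_nonneg cQw that) auto
    have M0: "M \<ge> 0" using bd[of 1] order.trans[of 0 "circle_norm q (G 1)" M] norm by simp
    have "\<phi> b \<le> M powr Q"
    proof (rule max_principle_disc[of \<phi>])
      show "continuous_on (cball 0 1) \<phi>" unfolding \<phi>_def by (rule circle_int_continuous_on[OF cQ])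
      show "\<phi> b \<le> M powr Q" if "b \<in> sphere 0 1" for b
      proof -
        have "\<phi> b = (\<phi> b powr (1 / Q)) powr Q" using nn[of b] that Q by (simp add: powr_powr)
        also have "\<dots> \<le> M powr Q" using bd[OF that] norm Q by (intro powr_mono2) auto
        finally show ?thesis .
      qed
      fix a :: complex assume a: "a \<in> ball 0 1"
      then obtain e where e: "e > 0" "e < 1 - cmod a"
        "\<And>w. w \<in> sphere 0 1 \<Longrightarrow> 2 * pi * \<bar>G a w\<bar> \<le> circle_int (\<lambda>v. \<bar>G (a + of_real e * v) w\<bar>)"
        using sub by blast
      have c2: "continuous_on (sphere 0 1 \<times> sphere 0 1) (\<lambda>(w, v). \<bar>G (a + of_real e * v) w\<bar> powr Q)"
        unfolding split_beta
        by (rule continuous_on_compose2[OF cQ, where f = "\<lambda>x. (a + of_real e * snd x, fst x)", simplified split_beta fst_conv snd_conv])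
          (use in_disc[OF e(1,2)] in \<open>auto intro!: continuous_intros\<close>)
      have "2 * pi * \<phi> a = circle_int (\<lambda>w. 2 * pi * \<bar>G a w\<bar> powr Q)"
        by (simp add: \<phi>_def circle_int_cmult)
      also have "\<dots> \<le> circle_int (\<lambda>w. circle_int (\<lambda>v. \<bar>G (a + of_real e * v) w\<bar> powr Q))"
      proof (rule circle_int_mono)
        show "continuous_on (sphere 0 1) (\<lambda>w. 2 * pi * \<bar>G a w\<bar> powr Q)"
          using a by (intro continuous_on_mult continuous_on_const cQw) auto
        show "continuous_on (sphere 0 1) (\<lambda>w. circle_int (\<lambda>v. \<bar>G (a + of_real e * v) w\<bar> powr Q))"
          by (rule circle_int_continuous_on[OF c2])
        fix w :: complex assume w: "w \<in> sphere 0 1"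
        have "continuous_on (sphere 0 1) (\<lambda>v. G (a + of_real e * v) w)"
          by (rule continuous_on_compose2[OF cb[OF w]]) (use in_disc[OF e(1,2)] in \<open>auto intro!: continuous_intros\<close>)
        then show "2 * pi * \<bar>G a w\<bar> powr Q \<le> circle_int (\<lambda>v. \<bar>G (a + of_real e * v) w\<bar> powr Q)"
          using e(3)[OF w] Q by (intro circle_int_powr_mean) (auto intro!: continuous_intros)
      qed
      also have "\<dots> = circle_int (\<lambda>v. \<phi> (a + of_real e * v))"
        unfolding \<phi>_def by (rule circle_int_swap[OF c2, simplified])
      finally show "\<exists>\<epsilon>>0. \<epsilon> < 1 - cmod a \<and> 2 * pi * \<phi> a \<le> circle_int (\<lambda>v. \<phi> (a + of_real \<epsilon> * v))"
        using e by blast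
    qed (rule b)
    then have "\<phi> b powr (1 / Q) \<le> (M powr Q) powr (1 / Q)"
      using nn[OF b] Q by (intro powr_mono2) auto
    then show ?thesis using norm M0 Q by (simp add: powr_powr)
  qed
qed

section \<open>Subharmonicity of the transplanted kernel\<close>

lemma circle_mean_value:
  assumes "continuous_on (cball 0 1) H" "H holomorphic_on ball 0 1"
  shows "circle_int H = 2 * of_real pi * H 0"
proof -
  have "((\<lambda>u. H u / (u - 0) ^ Suc 0) has_contour_integral (2 * pi * \<i>) / fact 0 * (deriv ^^ 0) H 0) (circlepath 0 1)"
    using assms by (intro Cauchy_has_contour_integral_higher_derivative_circlepath) auto
  then have "((\<lambda>t. H (cis t) / cis t * \<i> * cis t) has_integral 2 * pi * \<i> * H 0) {0..2 * pi}"
    unfolding circlepath_def by (subst (asm) has_contour_integral_part_circlepath_iff) auto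
  then have "((\<lambda>t. \<i> * H (cis t)) has_integral 2 * pi * \<i> * H 0) {0..2 * pi}"
    by (rule has_integral_eq[rotated]) simp
  then have "((\<lambda>t. - \<i> * (\<i> * H (cis t))) has_integral - \<i> * (2 * pi * \<i> * H 0)) {0..2 * pi}"
    by (rule has_integral_mult_right)
  then have "((\<lambda>t. H (cis t)) has_integral - \<i> * (2 * pi * \<i> * H 0)) {0..2 * pi}"
    by (rule has_integral_eq[rotated]) simp
  then have "((\<lambda>t. H (cis t)) has_integral 2 * of_real pi * H 0) {0..2 * pi}"
    by (rule has_integral_eq_rhs) (simp add: complex_eq_iff)
  then show ?thesis unfolding circle_int_def by (rule integral_unique)
qed

lemma circle_int_bounded_linear:
  assumes "bounded_linear L" "continuous_on (sphere 0 1) H"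
  shows "circle_int (\<lambda>w. L (H w)) = L (circle_int H)"
  unfolding circle_int_def
  using integral_linear[OF circle_integrable[OF assms(2)] assms(1)] by (simp add: o_def)

lemma circle_mean_value_Re:
  assumes "continuous_on (cball 0 1) H" "H holomorphic_on ball 0 1"
  shows "circle_int (\<lambda>w. Re (H w)) = 2 * pi * Re (H 0)"
proof -
  have "continuous_on (sphere 0 1) H" by (rule continuous_on_subset[OF assms(1)]) auto
  then show ?thesis
    using circle_int_bounded_linear[OF bounded_linear_Re, of H] circle_mean_value[OF assms] by simp
qed

text \<open>The left-hand side is the \<open>\<alpha>\<close>-harmonic function with the same value and slope at the
  origin as \<open>c cos (m\<psi>) - s sin (m\<psi>)\<close>, where \<open>y = \<alpha>\<psi>\<close> and \<open>t = m/\<alpha>\<close>; this is the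
  trigonometric convexity behind subharmonicity.\<close>

lemma trig_comparison:
  fixes c s t y :: real
  assumes t: "0 \<le> t" "t \<le> 1" and y: "\<bar>y\<bar> < pi / 2" and c: "0 \<le> c"
  shows "c * cos y - t * s * sin y \<le> \<bar>c * cos (t * y) - s * sin (t * y)\<bar>"
proof -
  have pos: "c * cos y - t * s * sin y \<le> \<bar>c * cos (t * y) - s * sin (t * y)\<bar>"
    if y: "0 \<le> y" "y < pi / 2" for s y :: real
  proof -
    \<comment> \<open>The chord from \<open>0\<close> of the function \<open>sin\<close>, concave on
      \<open>{0..pi}\<close>.\<close>
    have concave: "\<tau> * sin y \<le> sin (\<tau> * y)" if "0 \<le> \<tau>" "\<tau> \<le> 1" for \<tau>
    proof -
      have "convex_on {0..pi} (\<lambda>x. - sin x)"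
      proof (rule f''_ge0_imp_convex)
        show "((\<lambda>x. - sin x) has_real_derivative - cos x) (at x)" for x :: real
          by (auto intro!: derivative_eq_intros)
        show "((\<lambda>x. - cos x) has_real_derivative sin x) (at x)" for x :: real
          by (auto intro!: derivative_eq_intros)
        show "0 \<le> sin x" if "x \<in> {0..pi}" for x using that by (auto intro: sin_ge_zero)
      qed auto
      from convex_onD[OF this, of \<tau> 0 y] show ?thesis using that y by auto
    qed
    have ty: "0 \<le> t * y" "t * y \<le> y" using t y by (auto simp: mult_left_le_one_le)
    have cos_pos: "cos y > 0" "cos (t * y) > 0" "sin y \<ge> 0"
      using y ty by (auto intro!: cos_gt_zero sin_ge_zero cos_gt_zero_pi)
    have cos_le: "cos y \<le> cos (t * y)" using ty y by (intro cos_monotone_0_pi_le) auto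
    show ?thesis
    proof (cases "s \<le> 0")
      case True
      have "c * cos y + (- s) * (t * sin y) \<le> c * cos (t * y) + (- s) * sin (t * y)"
        using True c cos_le concave[OF t] by (intro add_mono mult_left_mono) auto
      then show ?thesis by (simp add: algebra_simps)
    next
      case False
      \<comment> \<open>For \<open>s > 0\<close> the claim is multiplied by
        \<open>cos (t * y)\<close>. It then rests on \<open>cos y \<le> cos (t * y)\<close> and on
        \<open>cos y * sin (t * y) \<le> t * sin y * cos (t * y)\<close>, which is the concavity
        bound for \<open>sin (y - t * y)\<close> expanded.\<close>
      have "(1 - t) * sin y * cos (t * y) \<le> (1 - t) * sin y * 1"
        using t cos_pos by (intro mult_left_mono mult_nonneg_nonneg) auto
      also have "\<dots> \<le> sin ((1 - t) * y)" using concave[of "1 - t"] t by simp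
      also have "(1 - t) * y = y - t * y" by (simp add: algebra_simps)
      finally have "cos y * sin (t * y) \<le> t * sin y * cos (t * y)"
        by (simp add: sin_diff algebra_simps)
      then have "s * (cos y * sin (t * y)) \<le> s * (t * sin y * cos (t * y))"
        using False by (intro mult_left_mono) auto
      then have "(c * cos y - t * s * sin y) * cos (t * y) \<le> cos y * (c * cos (t * y) - s * sin (t * y))"
        by (simp add: algebra_simps)
      also have "\<dots> \<le> cos y * \<bar>c * cos (t * y) - s * sin (t * y)\<bar>"
        using cos_pos by (intro mult_left_mono) auto
      also have "\<dots> \<le> cos (t * y) * \<bar>c * cos (t * y) - s * sin (t * y)\<bar>"
        using cos_le by (intro mult_right_mono) auto
      finally have "cos (t * y) * (c * cos y - t * s * sin y) \<le> cos (t * y) * \<bar>c * cos (t * y) - s * sin (t * y)\<bar>"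
        by (simp only: mult.commute)
      then show ?thesis using cos_pos by simp
    qed
  qed
  \<comment> \<open>Reversing the signs of \<open>y\<close> and \<open>s\<close> together changes
    neither side, so \<open>y \<ge> 0\<close> may be assumed.\<close>
  show ?thesis
    using pos[of y s] pos[of "-y" "-s"] y by (cases "0 \<le> y") auto
qed

text \<open>Unlike \<open>powr\<close>, for which \<open>0 powr 0 = 0\<close>, this is continuous at \<open>0\<close> also when \<open>\<sigma> = 0\<close>.\<close>

definition pow_weight :: "real \<Rightarrow> real \<Rightarrow> real" where
  "pow_weight \<sigma> x = (if \<sigma> = 0 then 1 else x powr \<sigma>)"

lemma pow_weight_nonneg [simp]: "0 \<le> pow_weight \<sigma> x"
  by (simp add: pow_weight_def)

lemma pow_weight_pos: "0 < x \<Longrightarrow> pow_weight \<sigma> x = x powr \<sigma>"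
  by (simp add: pow_weight_def)

lemma pow_weight_mult: "0 \<le> x \<Longrightarrow> 0 \<le> y \<Longrightarrow> pow_weight \<sigma> (x * y) = pow_weight \<sigma> x * pow_weight \<sigma> y"
  by (simp add: pow_weight_def powr_mult)

lemma continuous_on_pow_weight:
  fixes f :: "'a::topological_space \<Rightarrow> real"
  assumes "continuous_on S f" "\<And>x. x \<in> S \<Longrightarrow> 0 \<le> f x" "0 \<le> \<sigma>"
  shows "continuous_on S (\<lambda>x. pow_weight \<sigma> (f x))"
  using assms unfolding pow_weight_def
  by (cases "\<sigma> = 0") (auto intro!: continuous_on_powr')

text \<open>Secures the range \<open>\<bar>y\<bar> < pi / 2\<close> of
  \<open>trig_comparison\<close> for \<open>y = \<alpha> * Arg (1 + u)\<close>, uniformly on a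
  disc.\<close>

lemma Arg_near_one:
  assumes "0 \<le> \<alpha>"
  obtains \<delta> where "0 < \<delta>" "\<delta> < 1" "\<And>u. cmod u \<le> \<delta> \<Longrightarrow> \<alpha> * \<bar>Arg (1 + u)\<bar> < pi / 2"
proof -
  have "isCont Arg 1" by (rule continuous_at_Arg) auto
  \<comment> \<open>Dividing by \<open>\<alpha> + 1\<close> rather than by \<open>\<alpha>\<close>
    admits \<open>\<alpha> = 0\<close>.\<close>
  moreover have "pi / (2 * (\<alpha> + 1)) > 0" using assms by simp
  ultimately obtain d where d: "d > 0"
    "\<And>x. dist x 1 < d \<Longrightarrow> dist (Arg x) (Arg 1) < pi / (2 * (\<alpha> + 1))"
    unfolding continuous_at_eps_delta by blast
  show ?thesis
  proof (rule that[of "min (d / 2) (1 / 2)"])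
    fix u :: complex assume "cmod u \<le> min (d / 2) (1 / 2)"
    then have "dist (1 + u) 1 < d" using d(1) by (simp add: dist_norm)
    from d(2)[OF this] have "\<bar>Arg (1 + u)\<bar> < pi / (2 * (\<alpha> + 1))" by (simp add: dist_norm)
    then have "(\<alpha> + 1) * \<bar>Arg (1 + u)\<bar> < pi / 2" using assms by (simp add: field_simps)
    then show "\<alpha> * \<bar>Arg (1 + u)\<bar> < pi / 2" by (simp add: algebra_simps)
  qed (use d in auto)
qed

text \<open>The function is bounded below on the circle by the real part of a constant multiple of
  a branch of \<open>w powr (m + \<sigma>)\<close>, with equality at the centre.\<close>

lemma weighted_Re_power_submean:
  fixes c w0 \<xi> :: complex and \<sigma> :: real and m :: nat
  defines "B \<equiv> \<lambda>w. pow_weight \<sigma> (cmod w) * \<bar>Re (c * w ^ m)\<bar>"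
  assumes \<sigma>: "0 \<le> \<sigma>" and w0: "w0 \<noteq> 0" and \<delta>: "cmod \<xi> \<le> \<delta> * cmod w0" "\<delta> < 1"
    and arg: "\<And>u. cmod u \<le> \<delta> \<Longrightarrow> (real m + \<sigma>) * \<bar>Arg (1 + u)\<bar> < pi / 2"
  shows "2 * pi * B w0 \<le> circle_int (\<lambda>v. B (w0 + \<xi> * v))"
proof -
  define \<alpha> where "\<alpha> = real m + \<sigma>"
  \<comment> \<open>If \<open>\<alpha> = 0\<close>, then \<open>m = 0\<close> and division by zero
    gives \<open>t = 0\<close>, so \<open>t * \<alpha> = real m\<close> persists.\<close>
  define t where "t = real m / \<alpha>"
  have t: "0 \<le> t" "t \<le> 1" "t * \<alpha> = real m"
    using \<sigma> by (auto simp: t_def \<alpha>_def divide_le_eq_1)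
  define A where "A = c * w0 ^ m"
  \<comment> \<open>The sign \<open>e\<close> makes the coefficient of the cosine nonnegative, as
    \<open>trig_comparison\<close> demands, and disappears under the absolute value.\<close>
  define e where "e = (if Re A \<ge> 0 then 1 else -1 :: real)"
  define W where "W = pow_weight \<sigma> (cmod w0)"
  have W: "W \<ge> 0" by (simp add: W_def)
  define \<eta> where "\<eta> v = 1 + \<xi> / w0 * v" for v
  \<comment> \<open>Scaling \<open>Im A\<close> by \<open>t\<close> compensates for the faster
    rotation: differentiating in the angle brings out \<open>\<alpha>\<close>, and
    \<open>\<alpha> * t = m\<close>, so the slope at the centre matches that of the original
    power.\<close>
  define H where "H v = of_real (W * e) * Complex (Re A) (t * Im A) * exp (of_real \<alpha> * Ln (\<eta> v))" for v
  have small: "cmod (\<xi> / w0 * v) \<le> \<delta>" if "v \<in> cball 0 1" for v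
  proof -
    have "cmod (\<xi> / w0) \<le> \<delta>" using \<delta>(1) w0 by (simp add: norm_divide divide_le_eq)
    moreover have "cmod (\<xi> / w0 * v) \<le> cmod (\<xi> / w0) * 1"
      unfolding norm_mult using that by (intro mult_left_mono) auto
    ultimately show ?thesis by simp
  qed
  have pos: "Re (\<eta> v) > 0" if "v \<in> cball 0 1" for v
    using small[OF that] \<delta>(2) abs_Re_le_cmod[of "\<xi> / w0 * v"] unfolding \<eta>_def by auto
  then have nonpos: "\<eta> v \<notin> \<real>\<^sub>\<le>\<^sub>0" if "v \<in> cball 0 1" for v
    using that by (force simp: complex_nonpos_Reals_iff)
  have holH: "H holomorphic_on cball 0 1"
    unfolding H_def \<eta>_def by (intro holomorphic_intros) (use nonpos in \<open>auto simp: \<eta>_def\<close>)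
  then have contH: "continuous_on (cball 0 1) H" by (rule holomorphic_on_imp_continuous_on)
  have H0: "Re (H 0) = B w0"
  proof -
    have "Re (H 0) = W * (e * Re A)" by (simp add: H_def \<eta>_def)
    also have "e * Re A = \<bar>Re A\<bar>" by (simp add: e_def)
    finally show ?thesis by (simp only: B_def A_def W_def)
  qed
  have le: "Re (H v) \<le> B (w0 + \<xi> * v)" if "v \<in> sphere 0 1" for v
  proof -
    have v: "v \<in> cball 0 1" using that by auto
    define \<rho> where "\<rho> = cmod (\<eta> v)"
    define \<psi> where "\<psi> = Arg (\<eta> v)"
    have \<eta>0: "\<eta> v \<noteq> 0" using pos[OF v] by auto
    then have \<rho>: "\<rho> > 0" by (simp add: \<rho>_def)
    have \<eta>: "\<eta> v = rcis \<rho> \<psi>" by (simp add: \<rho>_def \<psi>_def rcis_cmod_Arg)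
    have "Ln (\<eta> v) = of_real (ln \<rho>) + \<i> * of_real \<psi>"
      by (rule complex_eqI) (use \<eta>0 in \<open>simp_all add: \<rho>_def \<psi>_def Arg_eq_Im_Ln\<close>)
    then have "exp (of_real \<alpha> * Ln (\<eta> v)) = exp (of_real (\<alpha> * ln \<rho>)) * exp (\<i> * of_real (\<alpha> * \<psi>))"
      by (simp add: exp_add[symmetric] algebra_simps)
    also have "\<dots> = of_real (\<rho> powr \<alpha>) * cis (\<alpha> * \<psi>)"
      using \<rho> by (simp add: cis_conv_exp powr_def exp_of_real[symmetric] del: exp_of_real)
    finally have "Re (H v) = W * \<rho> powr \<alpha> * (e * Re A * cos (\<alpha> * \<psi>) - t * (e * Im A) * sin (\<alpha> * \<psi>))"
      by (simp add: H_def algebra_simps)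
    also have "\<dots> \<le> W * \<rho> powr \<alpha> * \<bar>e * Re A * cos (t * (\<alpha> * \<psi>)) - e * Im A * sin (t * (\<alpha> * \<psi>))\<bar>"
    proof (intro mult_left_mono trig_comparison)
      have "\<alpha> * \<bar>\<psi>\<bar> < pi / 2"
        using arg[OF small[OF v]] by (simp add: \<psi>_def \<alpha>_def \<eta>_def)
      moreover have "\<alpha> \<ge> 0" using \<sigma> by (simp add: \<alpha>_def)
      ultimately show "\<bar>\<alpha> * \<psi>\<bar> < pi / 2" by (simp add: abs_mult)
    qed (use W t in \<open>auto simp: e_def\<close>)
    also have "t * (\<alpha> * \<psi>) = real m * \<psi>" using t(3) by (simp flip: mult.assoc)
    also have "\<bar>e * Re A * cos (real m * \<psi>) - e * Im A * sin (real m * \<psi>)\<bar>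
             = \<bar>Re A * cos (real m * \<psi>) - Im A * sin (real m * \<psi>)\<bar>"
      by (simp add: e_def abs_minus_commute)
    also have "W * \<rho> powr \<alpha> * \<dots> = B (w0 * \<eta> v)"
    proof -
      have "(w0 * \<eta> v) ^ m = w0 ^ m * (of_real (\<rho> ^ m) * cis \<psi> ^ m)"
        by (simp only: \<eta> rcis_def power_mult_distrib of_real_power)
      then have "c * (w0 * \<eta> v) ^ m = A * (of_real (\<rho> ^ m) * cis (real m * \<psi>))"
        by (simp only: A_def Complex.DeMoivre mult.assoc)
      then have "Re (c * (w0 * \<eta> v) ^ m) = \<rho> ^ m * (Re A * cos (real m * \<psi>) - Im A * sin (real m * \<psi>))"
        by (simp add: algebra_simps)
      moreover have "pow_weight \<sigma> (cmod (w0 * \<eta> v)) = W * \<rho> powr \<sigma>"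
        using \<rho> by (simp add: norm_mult pow_weight_mult W_def \<rho>_def[symmetric] pow_weight_pos)
      moreover have "\<rho> powr \<alpha> = \<rho> powr \<sigma> * \<rho> ^ m"
        using \<rho> by (simp add: \<alpha>_def powr_add powr_realpow)
      ultimately show ?thesis using \<rho> by (simp add: B_def abs_mult)
    qed
    also have "w0 * \<eta> v = w0 + \<xi> * v" using w0 by (simp add: \<eta>_def algebra_simps)
    finally show ?thesis .
  qed
  have "2 * pi * B w0 = circle_int (\<lambda>v. Re (H v))"
    using circle_mean_value_Re[OF contH holomorphic_on_subset[OF holH]] H0 by auto
  also have "\<dots> \<le> circle_int (\<lambda>v. B (w0 + \<xi> * v))"
  proof (rule circle_int_mono[OF _ _ le])
    show "continuous_on (sphere 0 1) (\<lambda>v. Re (H v))"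
      by (intro continuous_intros continuous_on_subset[OF contH]) auto
    show "continuous_on (sphere 0 1) (\<lambda>v. B (w0 + \<xi> * v))"
      unfolding B_def by (intro continuous_on_mult continuous_on_pow_weight continuous_intros \<sigma>) auto
  qed
  finally show ?thesis .
qed

text \<open>\<open>cnj w ^ n\<close> stands for \<open>w^(-n)\<close> on the circle in a form
  continuous everywhere, and \<open>pow_weight\<close> keeps the weight continuous at
  \<open>b * w = - 1\<close> also for \<open>q = 1\<close>.\<close>

definition disc_kernel :: "ennreal \<Rightarrow> nat \<Rightarrow> real \<Rightarrow> complex \<Rightarrow> complex \<Rightarrow> real" where
  "disc_kernel q n \<theta> b w = pow_weight (2 - 2 * enn2real (1 / q)) (cmod (1 + b * w))
     * Re (cis \<theta> * cnj w ^ n * (1 + b * w) ^ (n - 1))"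

lemma enn2real_inverse_le_1: "1 \<le> q \<Longrightarrow> enn2real (1 / q) \<le> 1"
proof (cases q rule: ennreal_cases)
  case (real Q)
  assume "1 \<le> q"
  then have "Q \<ge> 1" using real by simp
  then show ?thesis using real divide_ennreal[of 1 Q] by simp
qed simp

lemma continuous_on_disc_kernel:
  assumes "1 \<le> q"
  shows "continuous_on S (\<lambda>(b, w). disc_kernel q n \<theta> b w)"
  unfolding disc_kernel_def split_beta using enn2real_inverse_le_1[OF assms]
  by (intro continuous_on_mult continuous_on_pow_weight continuous_intros) auto

text \<open>For fixed \<open>w\<close> the kernel is a weighted power of the affine function
  \<open>1 + b * w\<close>, to which \<open>weighted_Re_power_submean\<close> applies with
  \<open>m = n - 1\<close>.\<close>

lemma disc_kernel_max_principle:
  assumes q: "1 \<le> q" and bd: "\<And>b. b \<in> sphere 0 1 \<Longrightarrow> circle_norm q (disc_kernel q n \<theta> b) \<le> M"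
    and b: "b \<in> cball 0 1"
  shows "circle_norm q (disc_kernel q n \<theta> b) \<le> M"
proof (rule circle_norm_max_principle[OF continuous_on_disc_kernel[OF q] _ bd q b])
  fix a :: complex assume a: "a \<in> ball 0 1"
  define \<sigma> where "\<sigma> = 2 - 2 * enn2real (1 / q)"
  have \<sigma>: "\<sigma> \<ge> 0" using enn2real_inverse_le_1[OF q] by (simp add: \<sigma>_def)
  then have "0 \<le> real (n - 1) + \<sigma>" by simp
  then obtain \<delta> where \<delta>: "0 < \<delta>" "\<delta> < 1" "\<And>u. cmod u \<le> \<delta> \<Longrightarrow> (real (n - 1) + \<sigma>) * \<bar>Arg (1 + u)\<bar> < pi / 2"
    using Arg_near_one by blast
  \<comment> \<open>\<open>1 - cmod a\<close> bounds \<open>cmod (1 + a * w)\<close> from below for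
    every \<open>w\<close> on the circle, so the radius is at most \<open>\<delta>\<close> relative
    to each of these moduli.\<close>
  define e where "e = \<delta> * (1 - cmod a)"
  have e: "0 < e" "e < 1 - cmod a" using \<delta> a by (auto simp: e_def)
  have "2 * pi * \<bar>disc_kernel q n \<theta> a w\<bar> \<le> circle_int (\<lambda>v. \<bar>disc_kernel q n \<theta> (a + of_real e * v) w\<bar>)"
    if w: "w \<in> sphere 0 1" for w
  proof -
    define w0 where "w0 = 1 + a * w"
    have ge: "1 - cmod a \<le> cmod w0"
      using norm_triangle_ineq2[of 1 "- (a * w)"] w by (simp add: w0_def norm_mult)
    then have "w0 \<noteq> 0" using a by auto
    have "cmod (of_real e * w) \<le> \<delta> * cmod w0"
    proof -
      have "cmod (of_real e * w) = e" using w e by (simp add: norm_mult)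
      then show ?thesis using ge \<delta>(1) by (simp add: e_def)
    qed
    from weighted_Re_power_submean[OF \<sigma> \<open>w0 \<noteq> 0\<close> this \<delta>(2,3), of "cis \<theta> * cnj w ^ n"]
    have sm: "2 * pi * (pow_weight \<sigma> (cmod w0) * \<bar>Re (cis \<theta> * cnj w ^ n * w0 ^ (n - 1))\<bar>)
      \<le> circle_int (\<lambda>v. pow_weight \<sigma> (cmod (w0 + of_real e * w * v))
          * \<bar>Re (cis \<theta> * cnj w ^ n * (w0 + of_real e * w * v) ^ (n - 1))\<bar>)" .
    have "w0 + of_real e * w * v = 1 + (a + of_real e * v) * w" for v
      by (simp add: w0_def algebra_simps)
    with sm show ?thesis
      by (simp only: disc_kernel_def \<sigma>_def[symmetric] w0_def abs_mult abs_of_nonneg[OF pow_weight_nonneg])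
  qed
  then show "\<exists>\<epsilon>>0. \<epsilon> < 1 - cmod a \<and> (\<forall>w\<in>sphere 0 1. 2 * pi * \<bar>disc_kernel q n \<theta> a w\<bar>
      \<le> circle_int (\<lambda>v. \<bar>disc_kernel q n \<theta> (a + of_real \<epsilon> * v) w\<bar>))"
    using e by blast
qed

section \<open>Cauchy's formula and the Moebius substitution\<close>

definition deriv_kernel :: "nat \<Rightarrow> real \<Rightarrow> complex \<Rightarrow> complex \<Rightarrow> real" where
  "deriv_kernel n \<theta> z w = Re (cis \<theta> * (w / (w - z) ^ (n + 1)))"

text \<open>Cauchy's formula for \<open>g\<close>, to which the vanishing integral of \<open>cnj g\<close> against the same
  kernel is added.\<close>

lemma higher_deriv_eq_circle_int:
  assumes holg: "g holomorphic_on ball 0 R" and R: "1 < R" and n: "1 \<le> n" and z: "cmod z < 1"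
  shows "(deriv ^^ n) g z = of_real (fact n / pi) * circle_int (\<lambda>w. of_real (Re (g w)) * (w / (w - z) ^ (n + 1)))"
proof -
  have sub: "cball 0 1 \<subseteq> ball (0::complex) R" using R by auto
  then have hol1: "g holomorphic_on cball 0 1" by (rule holomorphic_on_subset[OF holg])
  then have cont1: "continuous_on (cball 0 1) g" by (rule holomorphic_on_imp_continuous_on)
  have "((\<lambda>u. g u / (u - z) ^ Suc n) has_contour_integral (2 * pi * \<i>) / fact n * (deriv ^^ n) g z) (circlepath 0 1)"
    using z by (intro Cauchy_has_contour_integral_higher_derivative_circlepath cont1 holomorphic_on_subset[OF hol1]) auto
  then have "((\<lambda>t. g (cis t) / (cis t - z) ^ Suc n * \<i> * cis t) has_integral (2 * pi * \<i>) / fact n * (deriv ^^ n) g z) {0..2 * pi}"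
    unfolding circlepath_def by (subst (asm) has_contour_integral_part_circlepath_iff) auto
  then have "((\<lambda>t. - \<i> * (g (cis t) / (cis t - z) ^ Suc n * \<i> * cis t)) has_integral - \<i> * ((2 * pi * \<i>) / fact n * (deriv ^^ n) g z)) {0..2 * pi}"
    by (rule has_integral_mult_right)
  moreover have "- \<i> * ((2 * pi * \<i>) / fact n * (deriv ^^ n) g z) = 2 * of_real pi / fact n * (deriv ^^ n) g z"
    by (simp add: algebra_simps)
  moreover have "- \<i> * (g (cis t) / (cis t - z) ^ Suc n * \<i> * cis t) = g (cis t) * (cis t / (cis t - z) ^ (n + 1))" for t
    by (simp add: algebra_simps)
  ultimately have 1: "((\<lambda>t. g (cis t) * (cis t / (cis t - z) ^ (n + 1))) has_integral 2 * of_real pi / fact n * (deriv ^^ n) g z) {0..2 * pi}"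
    by simp

  \<comment> \<open>On the circle \<open>cnj w = 1 / w\<close>, so \<open>cnj (h w)\<close> is
    \<open>cnj (g w)\<close> times Cauchy's kernel. As \<open>n \<ge> 1\<close>, \<open>h\<close>
    vanishes at the origin and its mean is zero.\<close>
  define h where "h u = g u * u ^ n / (1 - cnj z * u) ^ (n + 1)" for u
  have nz: "1 - cnj z * u \<noteq> 0" if "cmod u \<le> 1" for u
  proof
    assume "1 - cnj z * u = 0"
    then have "cnj z * u = 1" by simp
    then have "cmod (cnj z * u) = 1" by simp
    then show False using that z mult_left_le[of "cmod u" "cmod z"] by (simp add: norm_mult)
  qed
  have "h holomorphic_on cball 0 1"
    unfolding h_def using nz by (intro holomorphic_intros hol1) auto
  then have "circle_int h = 2 * of_real pi * h 0"
    by (intro circle_mean_value holomorphic_on_imp_continuous_on) (auto elim: holomorphic_on_subset)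
  moreover have "h 0 = 0" using n by (simp add: h_def)
  moreover have ch: "continuous_on (sphere 0 1) h"
    using \<open>h holomorphic_on cball 0 1\<close> by (intro holomorphic_on_imp_continuous_on) (auto elim: holomorphic_on_subset)
  ultimately have "((\<lambda>t. h (cis t)) has_integral 0) {0..2 * pi}"
    using has_integral_circle_int[OF ch] by simp
  then have "((\<lambda>t. cnj (h (cis t))) has_integral 0) {0..2 * pi}"
    using has_integral_linear[OF _ bounded_linear_cnj, of "\<lambda>t. h (cis t)" 0] by (simp add: o_def)
  moreover have "cnj (h (cis t)) = cnj (g (cis t)) * (cis t / (cis t - z) ^ (n + 1))" for t
  proof -
    have "cis t - z = cis t * (1 - z * cis (- t))" by (simp add: algebra_simps cis_mult)
    then have "cis t / (cis t - z) ^ (n + 1) = cis t / (cis t ^ (n + 1) * (1 - z * cis (- t)) ^ (n + 1))"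
      by (simp add: power_mult_distrib)
    also have "\<dots> = cis (- t) ^ n / (1 - z * cis (- t)) ^ (n + 1)"
    proof -
      have "cis t ^ n * cis (- t) ^ n = 1" by (simp add: power_mult_distrib[symmetric] cis_mult)
      then have "cis (- t) ^ n = 1 / cis t ^ n" by (simp add: field_simps)
      then show ?thesis by simp
    qed
    finally show ?thesis by (simp add: h_def cis_cnj)
  qed
  ultimately have 2: "((\<lambda>t. cnj (g (cis t)) * (cis t / (cis t - z) ^ (n + 1))) has_integral 0) {0..2 * pi}"
    by simp
  \<comment> \<open>Half the sum of the two formulas replaces \<open>g\<close> by
    \<open>Re g\<close>; hence the factor \<open>fact n / pi\<close> in place of Cauchy's
    \<open>fact n / (2 * pi)\<close>.\<close>
  have "((\<lambda>t. of_real (1 / 2) * (g (cis t) * (cis t / (cis t - z) ^ (n + 1)) + cnj (g (cis t)) * (cis t / (cis t - z) ^ (n + 1))))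
      has_integral of_real (1 / 2) * (2 * of_real pi / fact n * (deriv ^^ n) g z + 0)) {0..2 * pi}"
    by (intro has_integral_mult_right has_integral_add 1 2)
  moreover have "of_real (1 / 2) * (x * K + cnj x * K) = of_real (Re x) * K" for x K
  proof -
    have "x * K + cnj x * K = (of_real 2 * of_real (Re x)) * K"
      by (simp only: distrib_right[symmetric] complex_add_cnj of_real_mult)
    then show ?thesis by simp
  qed
  moreover have "of_real (1 / 2) * (2 * of_real pi / fact n * (deriv ^^ n) g z + 0) = of_real pi / fact n * (deriv ^^ n) g z"
    by simp
  ultimately have "((\<lambda>t. of_real (Re (g (cis t))) * (cis t / (cis t - z) ^ (n + 1)))
      has_integral of_real pi / fact n * (deriv ^^ n) g z) {0..2 * pi}"
    by (simp only:)
  then have "circle_int (\<lambda>w. of_real (Re (g w)) * (w / (w - z) ^ (n + 1))) = of_real pi / fact n * (deriv ^^ n) g z"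
    unfolding circle_int_def by (rule integral_unique)
  then show ?thesis by simp
qed

lemma continuous_on_deriv_kernel:
  assumes "cmod z < 1"
  shows "continuous_on (sphere 0 1) (deriv_kernel n \<theta> z)"
  unfolding deriv_kernel_def using assms by (intro continuous_intros) auto

lemma Re_higher_deriv_eq_circle_int:
  assumes "g holomorphic_on ball 0 R" "1 < R" "1 \<le> n" "cmod z < 1"
  shows "Re (cis \<theta> * (deriv ^^ n) g z) = fact n / pi * circle_int (\<lambda>w. Re (g w) * deriv_kernel n \<theta> z w)"
proof -
  have Re_scale: "Re (of_real x * y) = x * Re y" for x y by simp
  let ?K = "\<lambda>w. of_real (Re (g w)) * (w / (w - z) ^ (n + 1))"
  have "g holomorphic_on sphere 0 1"
    using assms(2) by (intro holomorphic_on_subset[OF assms(1)]) auto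
  then have "continuous_on (sphere 0 1) g" by (rule holomorphic_on_imp_continuous_on)
  then have c: "continuous_on (sphere 0 1) ?K"
    using assms(4) by (intro continuous_intros) auto
  have "bounded_linear (\<lambda>x. Re (cis \<theta> * x))"
    by (intro bounded_linear_compose[OF bounded_linear_Re] bounded_linear_mult_right)
  from circle_int_bounded_linear[OF this c]
  have "Re (cis \<theta> * circle_int ?K) = circle_int (\<lambda>w. Re (cis \<theta> * ?K w))" by simp
  also have "\<dots> = circle_int (\<lambda>w. Re (g w) * deriv_kernel n \<theta> z w)"
  proof (rule circle_int_cong)
    fix w
    have "Re (cis \<theta> * ?K w) = Re (of_real (Re (g w)) * (cis \<theta> * (w / (w - z) ^ (n + 1))))"
      by (simp only: mult_ac)
    then show "Re (cis \<theta> * ?K w) = Re (g w) * deriv_kernel n \<theta> z w"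
      by (simp only: deriv_kernel_def Re_scale)
  qed
  finally have "Re (cis \<theta> * circle_int ?K) = circle_int (\<lambda>w. Re (g w) * deriv_kernel n \<theta> z w)" .
  moreover have "Re (cis \<theta> * (deriv ^^ n) g z) = fact n / pi * Re (cis \<theta> * circle_int ?K)"
  proof -
    have "cis \<theta> * (deriv ^^ n) g z = of_real (fact n / pi) * (cis \<theta> * circle_int ?K)"
      by (simp only: higher_deriv_eq_circle_int[OF assms] mult_ac)
    then show ?thesis by (simp only: Re_scale)
  qed
  ultimately show ?thesis by simp
qed

section \<open>The Moebius substitution on the circle\<close>

definition moebius :: "complex \<Rightarrow> complex \<Rightarrow> complex" where
  "moebius z w = (w + z) / (1 + cnj z * w)"

lemma one_plus_cnj_mult_nonzero:
  assumes "cmod z < 1" "cmod w \<le> 1"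
  shows "1 + cnj z * w \<noteq> 0" "0 < Re (1 + cnj z * w)"
proof -
  have "cmod (cnj z * w) < 1"
    using assms mult_left_le[of "cmod w" "cmod z"] by (simp add: norm_mult)
  then show "0 < Re (1 + cnj z * w)" using abs_Re_le_cmod[of "cnj z * w"] by simp
  then show "1 + cnj z * w \<noteq> 0" by force
qed

lemma moebius_circle:
  assumes "cmod z < 1" "cmod w = 1"
  shows "w + z = w * cnj (1 + cnj z * w)" "cmod (moebius z w) = 1" "moebius (- z) (moebius z w) = w"
proof -
  have ww: "w * cnj w = 1" using assms(2) by (metis complex_norm_square of_real_1 one_power2)
  then show eq: "w + z = w * cnj (1 + cnj z * w)" by (simp add: algebra_simps)
  note nz = one_plus_cnj_mult_nonzero(1)[OF assms(1), of w]
  show "cmod (moebius z w) = 1"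
    using nz assms(2) unfolding moebius_def eq by (simp add: norm_divide norm_mult del: complex_cnj_add)
  have ne: "1 - cnj z * z \<noteq> 0"
    using one_plus_cnj_mult_nonzero(1)[of z "- z"] assms(1) by simp
  have "(moebius z w - z) * (1 + cnj z * w) = w * (1 - cnj z * z)"
    "(1 - cnj z * moebius z w) * (1 + cnj z * w) = 1 - cnj z * z"
  proof -
    have m: "moebius z w * (1 + cnj z * w) = w + z" using nz assms(2) by (simp add: moebius_def)
    have "(moebius z w - z) * (1 + cnj z * w) = moebius z w * (1 + cnj z * w) - z * (1 + cnj z * w)"
      by (simp only: left_diff_distrib)
    then show "(moebius z w - z) * (1 + cnj z * w) = w * (1 - cnj z * z)"
      unfolding m by (simp add: algebra_simps)
    have "(1 - cnj z * moebius z w) * (1 + cnj z * w) = 1 + cnj z * w - cnj z * (moebius z w * (1 + cnj z * w))"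
      by (simp only: left_diff_distrib mult_1 mult.assoc)
    then show "(1 - cnj z * moebius z w) * (1 + cnj z * w) = 1 - cnj z * z"
      unfolding m by (simp add: algebra_simps)
  qed
  then have "(moebius z w - z) * (1 + cnj z * w) = w * ((1 - cnj z * moebius z w) * (1 + cnj z * w))"
    by simp
  then have "moebius z w - z = w * (1 - cnj z * moebius z w)"
    using nz assms(2) by (simp add: mult.assoc[symmetric])
  moreover have "1 - cnj z * moebius z w \<noteq> 0"
    using ne nz assms(2) \<open>(1 - cnj z * moebius z w) * (1 + cnj z * w) = 1 - cnj z * z\<close> by auto
  ultimately show "moebius (- z) (moebius z w) = w"
    by (simp add: moebius_def[of "- z"])
qed

text \<open>With \<open>d = 1 + cnj z * w\<close> one has \<open>moebius z w = w * cnj d / d\<close>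
  and \<open>moebius z w - z = w * (1 - (cmod z)\<^sup>2) / d\<close>. The \<open>n + 1\<close>
  factors \<open>d\<close> from the denominator meet \<open>cnj d / d\<close>, leaving
  \<open>d * cnj d\<close> and \<open>d ^ (n - 1)\<close>.\<close>

lemma deriv_kernel_moebius:
  assumes z: "cmod z < 1" and w: "cmod w = 1" and n: "1 \<le> n"
  shows "(1 - (cmod z)\<^sup>2) ^ (n + 1) * deriv_kernel n \<theta> z (moebius z w)
    = (cmod (1 + cnj z * w))\<^sup>2 * Re (cis \<theta> * cnj w ^ n * (1 + cnj z * w) ^ (n - 1))"
proof -
  have Re_scale: "Re (of_real x * y) = x * Re y" for x y by simp
  define d where "d = 1 + cnj z * w"
  have d: "d \<noteq> 0" using one_plus_cnj_mult_nonzero(1)[OF z] w by (simp add: d_def)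
  have w0: "w \<noteq> 0" using w by auto
  have cw: "cnj w = inverse w"
    using w w0 by (metis complex_norm_square inverse_unique of_real_1 one_power2)
  define s where "s = 1 - (cmod z)\<^sup>2"
  have s: "of_real s = 1 - z * cnj z" by (simp only: s_def of_real_diff of_real_1 complex_norm_square)
  have "cmod z ^ 2 < 1" using z by (simp add: power_less_one_iff abs_square_less_1)
  then have s0: "s > 0" by (simp add: s_def)
  have mz: "moebius z w - z = w * of_real s / d"
    using d unfolding moebius_def d_def[symmetric] s by (simp add: field_simps) (simp add: d_def algebra_simps)
  have m: "moebius z w = w * cnj d / d"
    using moebius_circle(1)[OF z w] by (simp add: moebius_def d_def)
  have pw: "w ^ (n + 1) \<noteq> 0" "d ^ (n + 1) \<noteq> 0" using w0 d by auto
  have "of_real (s ^ (n + 1)) * (moebius z w / (moebius z w - z) ^ (n + 1))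
      = of_real (s ^ (n + 1)) * (w * cnj d / d / (w * of_real s / d) ^ (n + 1))"
    by (simp only: mz) (simp only: m)
  also have "\<dots> = cnj w ^ n * (d * cnj d) * d ^ (n - 1)"
  proof -
    obtain k where k: "n = Suc k" using n by (cases n) auto
    have *: "T * (w * c / d / (w * (w * W) * T / (d * (d * D)))) = (d * c) * D / (w * W)"
      if "T \<noteq> 0" "W \<noteq> 0" "D \<noteq> 0" for T c W D
      using w0 d that by (simp add: divide_simps)
    have "S ^ Suc (Suc k) * (w * c / d / (w * S / d) ^ Suc (Suc k)) = inverse w ^ Suc k * (d * c) * d ^ k"
      if "S \<noteq> 0" for S c
    proof -
      have "(w * S / d) ^ Suc (Suc k) = w * (w * w ^ k) * S ^ Suc (Suc k) / (d * (d * d ^ k))"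
        by (simp add: power_divide power_mult_distrib)
      then have "S ^ Suc (Suc k) * (w * c / d / (w * S / d) ^ Suc (Suc k)) = (d * c) * d ^ k / (w * w ^ k)"
        using *[of "S ^ Suc (Suc k)" "w ^ k" "d ^ k" c] w0 d that by simp
      also have "\<dots> = inverse w ^ Suc k * (d * c) * d ^ k"
        by (simp only: power_Suc divide_inverse inverse_mult_distrib power_inverse mult_ac)
      finally show ?thesis .
    qed
    from this[of "of_real s" "cnj d"] show ?thesis
      using s0 by (simp only: k cw of_real_power Suc_eq_plus1[symmetric] diff_Suc_1 of_real_eq_0_iff)
  qed
  also have "d * cnj d = of_real ((cmod d)\<^sup>2)" by (simp only: complex_norm_square)
  finally have "of_real (s ^ (n + 1)) * (cis \<theta> * (moebius z w / (moebius z w - z) ^ (n + 1)))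
      = of_real ((cmod d)\<^sup>2) * (cis \<theta> * cnj w ^ n * d ^ (n - 1))"
    by (simp only: mult_ac)
  then have "Re (of_real (s ^ (n + 1)) * (cis \<theta> * (moebius z w / (moebius z w - z) ^ (n + 1))))
      = Re (of_real ((cmod d)\<^sup>2) * (cis \<theta> * cnj w ^ n * d ^ (n - 1)))" by (rule arg_cong)
  then show ?thesis
    unfolding deriv_kernel_def s_def[symmetric] d_def[symmetric]
    by (simp only: Re_scale)
qed

text \<open>Since \<open>moebius z w = w * cnj d / d\<close>, the angle of
  \<open>moebius z (cis s)\<close> lifts continuously to
  \<open>\<tau> s = s - 2 * Im (Ln (d s))\<close>; the principal branch serves because
  \<open>Re (d s) > 0\<close>. One turn of \<open>s\<close> advances \<open>\<tau>\<close> by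
  \<open>2 * pi\<close>.\<close>

lemma circle_int_moebius:
  fixes h :: "complex \<Rightarrow> real"
  assumes h: "continuous_on (sphere 0 1) h" and z: "cmod z < 1"
  shows "circle_int h = circle_int (\<lambda>w. (1 - (cmod z)\<^sup>2) / (cmod (1 + cnj z * w))\<^sup>2 * h (moebius z w))"
proof -
  define d where "d s = 1 + cnj z * cis s" for s
  define \<tau> where "\<tau> s = s - 2 * Im (Ln (d s))" for s
  define D where "D s = (1 - (cmod z)\<^sup>2) / (cmod (d s))\<^sup>2" for s
  have d: "d s \<noteq> 0" "0 < Re (d s)" for s
    using one_plus_cnj_mult_nonzero[OF z, of "cis s"] by (simp_all add: d_def)
  have nonpos: "d s \<notin> \<real>\<^sub>\<le>\<^sub>0" for s
    using d(2)[of s] by (auto simp: complex_nonpos_Reals_iff)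
  have deriv: "(\<tau> has_real_derivative D s) (at s within T)" for s T
  proof -
    have "((\<lambda>x. 1 + cnj z * exp (\<i> * x)) has_field_derivative cnj z * (exp (\<i> * of_real s) * \<i>)) (at (of_real s))"
      by (auto intro!: derivative_eq_intros)
    from DERIV_chain2[OF has_field_derivative_Ln this] nonpos[of s]
    have "((\<lambda>x. Ln (1 + cnj z * exp (\<i> * x))) has_field_derivative
        inverse (d s) * (cnj z * (exp (\<i> * of_real s) * \<i>))) (at (of_real s))"
      by (simp add: d_def cis_conv_exp)
    from has_vector_derivative_real_field[OF this, of T]
    have "((\<lambda>x. Ln (d x)) has_vector_derivative cnj z * \<i> * cis s / d s) (at s within T)"
      by (simp add: d_def cis_conv_exp divide_inverse mult_ac)
    from bounded_linear.has_vector_derivative[OF bounded_linear_Im this]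
    have "((\<lambda>x. Im (Ln (d x))) has_real_derivative Im (cnj z * \<i> * cis s / d s)) (at s within T)"
      by (simp add: has_real_derivative_iff_has_vector_derivative)
    then have "(\<tau> has_real_derivative 1 - 2 * Im (cnj z * \<i> * cis s / d s)) (at s within T)"
      unfolding \<tau>_def by (intro DERIV_diff DERIV_ident DERIV_cmult)
    moreover have "1 - 2 * Im (cnj z * \<i> * cis s / d s) = D s"
    proof -
      have "cnj z * \<i> * cis s / d s = \<i> * ((d s - 1) / d s)" by (simp add: d_def)
      also have "\<dots> = \<i> * (1 - 1 / d s)" using d(1)[of s] by (simp add: diff_divide_distrib)
      finally have "Im (cnj z * \<i> * cis s / d s) = 1 - Re (1 / d s)" by simp
      also have "Re (1 / d s) = Re (d s) / (cmod (d s))\<^sup>2"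
        by (simp add: Re_divide cmod_power2)
      finally have eq: "1 - 2 * Im (cnj z * \<i> * cis s / d s) = 2 * (Re (d s) / (cmod (d s))\<^sup>2) - 1" by simp
      \<comment> \<open>Expansion of \<open>cmod (d s - 1) = cmod z\<close>.\<close>
      have "(cmod (d s))\<^sup>2 = 2 * Re (d s) - 1 + (cmod z)\<^sup>2"
      proof -
        have "(cmod z)\<^sup>2 = (cmod (d s - 1))\<^sup>2" by (simp add: d_def norm_mult)
        then show ?thesis unfolding cmod_power2 by (simp add: power2_eq_square algebra_simps)
      qed
      then show ?thesis unfolding eq D_def using d(1)[of s] by (simp add: field_simps)
    qed
    ultimately show ?thesis by simp
  qed
  have Arg_bound: "\<bar>Im (Ln (d s))\<bar> \<le> pi" for s
    using mpi_less_Im_Ln[of "d s"] Im_Ln_le_pi[of "d s"] d(1) by simp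
  have period: "\<tau> (2 * pi) = \<tau> 0 + 2 * pi" by (simp add: \<tau>_def d_def)
  have cis_\<tau>: "cis (\<tau> s) = moebius z (cis s)" for s
  proof -
    define \<phi> where "\<phi> = Im (Ln (d s))"
    obtain \<rho> :: real where \<rho>: "d s = of_real \<rho> * cis \<phi>" "\<rho> \<noteq> 0"
      using rcis_cmod_Arg[of "d s"] d(1)[of s] that[of "cmod (d s)"] by (simp add: rcis_def Arg_eq_Im_Ln \<phi>_def)
    have "cnj (d s) / d s = cis (- \<phi>) / cis \<phi>"
      unfolding \<rho>(1) using \<rho>(2) by (simp add: cis_cnj)
    also have "\<dots> = cis (- 2 * \<phi>)" by (simp add: cis_divide)
    finally have "cis s * (cnj (d s) / d s) = cis (\<tau> s)" by (simp add: cis_mult \<tau>_def \<phi>_def)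
    then show ?thesis
      using moebius_circle(1)[OF z, of "cis s"] by (simp add: moebius_def d_def)
  qed
  have "((\<lambda>s. D s *\<^sub>R h (cis (\<tau> s))) has_integral integral {\<tau> 0..\<tau> (2 * pi)} (\<lambda>t. h (cis t))) {0..2 * pi}"
  proof (rule has_integral_substitution[of 0 "2 * pi" \<tau> "- 2 * pi" "4 * pi"])
    \<comment> \<open>\<open>2 * Im (Ln (d s))\<close> is at most \<open>2 * pi\<close> in modulus,
      so this interval contains the image.\<close>
    show "\<tau> ` {0..2 * pi} \<subseteq> {- 2 * pi..4 * pi}"
    proof safe
      fix x assume "x \<in> {0..2 * pi}"
      then show "\<tau> x \<in> {- 2 * pi..4 * pi}"
        using Arg_bound[of x] unfolding \<tau>_def abs_le_iff atLeastAtMost_iff by linarith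
    qed
    show "continuous_on {- 2 * pi..4 * pi} (\<lambda>t. h (cis t))"
      using continuous_on_circle_param[OF h, of _ 0] by simp
  qed (use period deriv in auto)
  moreover have "integral {\<tau> 0..\<tau> (2 * pi)} (\<lambda>t. h (cis t)) = circle_int h"
    unfolding period by (rule circle_int_shift[OF h])
  ultimately have "((\<lambda>s. D s * h (moebius z (cis s))) has_integral circle_int h) {0..2 * pi}"
    by (simp add: cis_\<tau>)
  then have "integral {0..2 * pi} (\<lambda>s. D s * h (moebius z (cis s))) = circle_int h"
    by (rule integral_unique)
  then show ?thesis
    by (simp only: circle_int_def[of "\<lambda>w. _ w * _ w"] D_def d_def circle_int_def)
qed

text \<open>With \<open>s = 1 - (cmod z)\<^sup>2\<close>, the kernel identity yields
  \<open>s\<close> to the power \<open>- n - 1\<close> and the Jacobian \<open>s\<close> to the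
  power \<open>1/q\<close>. For \<open>q = \<infinity>\<close> the argument is that the Moebius map
  permutes the circle.\<close>

lemma circle_norm_deriv_kernel:
  assumes q: "1 \<le> q" and z: "cmod z < 1" and n: "1 \<le> n"
  shows "circle_norm q (deriv_kernel n \<theta> z)
    = (1 - (cmod z)\<^sup>2) powr (enn2real (1 / q) - real n - 1) * circle_norm q (disc_kernel q n \<theta> (cnj z))"
proof -
  define s where "s = 1 - (cmod z)\<^sup>2"
  have s: "s > 0" using z by (simp add: s_def power_less_one_iff abs_square_less_1)
  note kern = deriv_kernel_moebius[OF z _ n, folded s_def]
  have ck: "continuous_on (sphere 0 1) (deriv_kernel n \<theta> z)" by (rule continuous_on_deriv_kernel[OF z])
  have cd: "continuous_on (sphere 0 1) (disc_kernel q n \<theta> b)" for b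
    using continuous_on_compose2[OF continuous_on_disc_kernel[OF q, of UNIV n \<theta>], of "sphere 0 1" "\<lambda>w. (b, w)"]
    by (simp add: continuous_on_Pair)
  show ?thesis unfolding s_def[symmetric]
  proof (cases q rule: ennreal_cases)
    case top
    have rel: "s ^ (n + 1) * \<bar>deriv_kernel n \<theta> z (moebius z w)\<bar> = \<bar>disc_kernel q n \<theta> (cnj z) w\<bar>"
      if w: "w \<in> sphere 0 1" for w
    proof -
      have "1 + cnj z * w \<noteq> 0" using one_plus_cnj_mult_nonzero(1)[OF z, of w] w by simp
      then have "disc_kernel q n \<theta> (cnj z) w = s ^ (n + 1) * deriv_kernel n \<theta> z (moebius z w)"
        using kern[of w] w top by (simp add: disc_kernel_def pow_weight_pos)
      then show ?thesis using s by (simp add: abs_mult)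
    qed
    have "circle_norm \<infinity> (disc_kernel q n \<theta> (cnj z)) \<le> s ^ (n + 1) * circle_norm \<infinity> (deriv_kernel n \<theta> z)"
    proof (rule circle_norm_top_le)
      fix w :: complex assume w: "w \<in> sphere 0 1"
      have "\<bar>deriv_kernel n \<theta> z (moebius z w)\<bar> \<le> circle_norm \<infinity> (deriv_kernel n \<theta> z)"
        using moebius_circle(2)[OF z] w by (intro abs_le_circle_norm_top[OF ck]) auto
      then show "\<bar>disc_kernel q n \<theta> (cnj z) w\<bar> \<le> s ^ (n + 1) * circle_norm \<infinity> (deriv_kernel n \<theta> z)"
        unfolding rel[OF w, symmetric] using s by (intro mult_left_mono) auto
    qed
    moreover have "circle_norm \<infinity> (deriv_kernel n \<theta> z) \<le> circle_norm \<infinity> (disc_kernel q n \<theta> (cnj z)) / s ^ (n + 1)"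
    proof (rule circle_norm_top_le)
      fix w :: complex assume w: "w \<in> sphere 0 1"
      define v where "v = moebius (- z) w"
      have v: "v \<in> sphere 0 1" "moebius z v = w"
        using moebius_circle(2,3)[of "- z" w] z w by (auto simp: v_def)
      have "s ^ (n + 1) * \<bar>deriv_kernel n \<theta> z w\<bar> \<le> circle_norm \<infinity> (disc_kernel q n \<theta> (cnj z))"
        using rel[OF v(1)] v abs_le_circle_norm_top[OF cd v(1)] by simp
      then show "\<bar>deriv_kernel n \<theta> z w\<bar> \<le> circle_norm \<infinity> (disc_kernel q n \<theta> (cnj z)) / s ^ (n + 1)"
        using s by (simp add: field_simps)
    qed
    ultimately have "circle_norm \<infinity> (deriv_kernel n \<theta> z) = circle_norm \<infinity> (disc_kernel q n \<theta> (cnj z)) / s ^ (n + 1)"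
      using s by (simp add: field_simps)
    moreover have "s powr (- real n - 1) = inverse (s ^ (n + 1))"
    proof -
      have "s powr (- real n - 1) = s powr (- real (n + 1))" by (rule arg_cong) simp
      also have "\<dots> = inverse (s ^ (n + 1))" using s by (simp only: powr_minus powr_realpow)
      finally show ?thesis .
    qed
    ultimately show "circle_norm q (deriv_kernel n \<theta> z) = s powr (enn2real (1 / q) - real n - 1) * circle_norm q (disc_kernel q n \<theta> (cnj z))"
      using top by (simp add: divide_inverse mult.commute)
  next
    case (real Q)
    then have Q: "Q \<ge> 1" using q by simp
    have q': "enn2real (1 / q) = 1 / Q" using real Q divide_ennreal[of 1 Q] by simp
    let ?N = "circle_int (\<lambda>w. \<bar>disc_kernel q n \<theta> (cnj z) w\<bar> powr Q)"
    have "circle_int (\<lambda>w. \<bar>deriv_kernel n \<theta> z w\<bar> powr Q)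
        = circle_int (\<lambda>w. s / (cmod (1 + cnj z * w))\<^sup>2 * \<bar>deriv_kernel n \<theta> z (moebius z w)\<bar> powr Q)"
      unfolding s_def using Q by (intro circle_int_moebius z continuous_on_abs_powr ck) auto
    also have "\<dots> = circle_int (\<lambda>w. s powr (1 - (real n + 1) * Q) * \<bar>disc_kernel q n \<theta> (cnj z) w\<bar> powr Q)"
    proof (rule circle_int_cong)
      fix w :: complex assume w: "w \<in> sphere 0 1"
      define \<rho> where "\<rho> = cmod (1 + cnj z * w)"
      define R where "R = \<bar>Re (cis \<theta> * cnj w ^ n * (1 + cnj z * w) ^ (n - 1))\<bar>"
      have \<rho>: "\<rho> > 0" using one_plus_cnj_mult_nonzero(1)[OF z, of w] w by (simp add: \<rho>_def)
      have "s ^ (n + 1) * \<bar>deriv_kernel n \<theta> z (moebius z w)\<bar> = \<bar>s ^ (n + 1) * deriv_kernel n \<theta> z (moebius z w)\<bar>"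
        using s by (simp add: abs_mult)
      also have "\<dots> = \<rho>\<^sup>2 * R" using kern[of w] w by (simp add: abs_mult \<rho>_def R_def del: power_Suc)
      finally have eq: "s ^ (n + 1) * \<bar>deriv_kernel n \<theta> z (moebius z w)\<bar> = \<rho>\<^sup>2 * R" .
      have "\<bar>deriv_kernel n \<theta> z (moebius z w)\<bar> = s powr (- (real n + 1)) * (\<rho> powr 2 * R)"
      proof -
        have "s powr (- (real n + 1)) = s powr (- real (n + 1))" by (rule arg_cong) simp
        also have "\<dots> = inverse (s ^ (n + 1))" using s by (simp only: powr_minus powr_realpow)
        finally have p: "s powr (- (real n + 1)) = inverse (s ^ (n + 1))" .
        have X: "x = inverse T * y" if "T * x = y" "T \<noteq> 0" for x y T :: real
          using that by auto
        have "\<rho> powr 2 = \<rho>\<^sup>2" using \<rho> by simp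
        then show ?thesis unfolding p by (intro X) (use s eq in \<open>simp_all del: power_Suc\<close>)
      qed
      then have "\<bar>deriv_kernel n \<theta> z (moebius z w)\<bar> powr Q = s powr (- (real n + 1) * Q) * (\<rho> powr (2 * Q) * R powr Q)"
        by (simp add: powr_mult powr_powr R_def)
      moreover have "\<bar>disc_kernel q n \<theta> (cnj z) w\<bar> powr Q = \<rho> powr (2 * Q - 2) * R powr Q"
      proof -
        have "\<bar>disc_kernel q n \<theta> (cnj z) w\<bar> = \<rho> powr (2 - 2 / Q) * R"
          using \<rho> by (simp add: disc_kernel_def abs_mult R_def \<rho>_def q' pow_weight_pos)
        moreover have "(2 - 2 / Q) * Q = 2 * Q - 2" using Q by (simp add: field_simps)
        ultimately show ?thesis by (simp add: powr_mult powr_powr R_def)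
      qed
      moreover have "\<rho> powr (2 * Q) = \<rho>\<^sup>2 * \<rho> powr (2 * Q - 2)"
        using \<rho> by (simp add: powr_diff)
      moreover have "s powr (1 - (real n + 1) * Q) = s * s powr (- (real n + 1) * Q)"
        using powr_mult_base[of s "- (real n + 1) * Q"] s by (simp add: algebra_simps)
      ultimately show "s / (cmod (1 + cnj z * w))\<^sup>2 * \<bar>deriv_kernel n \<theta> z (moebius z w)\<bar> powr Q
          = s powr (1 - (real n + 1) * Q) * \<bar>disc_kernel q n \<theta> (cnj z) w\<bar> powr Q"
        using \<rho> by (simp add: \<rho>_def[symmetric])
    qed
    also have "\<dots> = s powr (1 - (real n + 1) * Q) * ?N" by (rule circle_int_cmult)
    finally have "circle_norm q (deriv_kernel n \<theta> z) = (s powr (1 - (real n + 1) * Q) * ?N) powr (1 / Q)"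
      using real Q by (simp add: circle_norm_real)
    also have "\<dots> = s powr ((1 - (real n + 1) * Q) / Q) * circle_norm q (disc_kernel q n \<theta> (cnj z))"
      using real Q by (simp add: circle_norm_real powr_mult powr_powr)
    also have "(1 - (real n + 1) * Q) / Q = enn2real (1 / q) - real n - 1"
      using Q q' by (simp add: field_simps)
    finally show "circle_norm q (deriv_kernel n \<theta> z) = s powr (enn2real (1 / q) - real n - 1) * circle_norm q (disc_kernel q n \<theta> (cnj z))" .
  qed
qed

section \<open>The extremal constant\<close>

lemma circle_norm_rotate:
  assumes "continuous_on (sphere 0 1) U" "b \<in> sphere 0 1" "1 \<le> q"
  shows "circle_norm q (\<lambda>w. U (b * w)) = circle_norm q U"
proof (cases q rule: ennreal_cases)
  case (real Q)
  then have "Q \<ge> 1" using assms by simp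
  then show ?thesis
    using real circle_int_rotate[OF continuous_on_abs_powr[OF assms(1)] assms(2), of Q]
    by (simp add: circle_norm_real)
next
  case top
  have *: "circle_norm \<infinity> (\<lambda>w. U (b * w)) \<le> circle_norm \<infinity> U"
    if "continuous_on (sphere 0 1) U" "b \<in> sphere 0 1" for U b
    using abs_le_circle_norm_top[OF that(1)] that(2) by (intro circle_norm_top_le) (auto simp: norm_mult)
  have cb: "cnj b \<in> sphere 0 1" "b * cnj b = 1"
    using assms(2) complex_norm_square[of b] by auto
  have "continuous_on (sphere 0 1) (\<lambda>w. U (b * w))"
    by (rule continuous_on_compose2[OF assms(1)]) (use assms(2) in \<open>auto simp: norm_mult intro!: continuous_intros\<close>)
  from *[OF this cb(1)] have "circle_norm \<infinity> U \<le> circle_norm \<infinity> (\<lambda>w. U (b * w))"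
    by (simp add: mult.assoc[symmetric] cb(2))
  then show ?thesis using *[OF assms(1,2)] top by simp
qed

lemma circle_norm_cnj:
  assumes "continuous_on (sphere 0 1) U" "1 \<le> q"
  shows "circle_norm q (\<lambda>w. U (cnj w)) = circle_norm q U"
proof (cases q rule: ennreal_cases)
  case (real Q)
  then have Q: "Q \<ge> 1" using assms by simp
  let ?h = "\<lambda>w. \<bar>U w\<bar> powr Q"
  have c: "continuous_on (sphere 0 1) ?h" using Q assms by (intro continuous_on_abs_powr) auto
  have "circle_int (\<lambda>w. ?h (cnj w)) = integral {- 2 * pi..0} (\<lambda>t. ?h (cis t))"
    unfolding circle_int_def
    using Henstock_Kurzweil_Integration.integral_reflect_real[of "2 * pi" 0 "\<lambda>t. ?h (cis (- t))"]
    by (simp add: cis_cnj del: Henstock_Kurzweil_Integration.integral_reflect_real)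
  also have "\<dots> = circle_int ?h" using circle_int_shift[OF c, of "- 2 * pi"] by simp
  finally show ?thesis using real Q by (simp add: circle_norm_real)
next
  case top
  have *: "circle_norm \<infinity> (\<lambda>w. U (cnj w)) \<le> circle_norm \<infinity> U"
    if "continuous_on (sphere 0 1) U" for U
    using abs_le_circle_norm_top[OF that(1)] by (intro circle_norm_top_le) auto
  have "continuous_on (sphere 0 1) (\<lambda>w. U (cnj w))"
    by (rule continuous_on_compose2[OF assms(1)]) (auto intro!: continuous_intros)
  from *[OF this] *[OF assms(1)] show ?thesis using top by simp
qed

text \<open>For \<open>q = \<infinity>\<close>, uniform continuity on the compact product
  \<open>S \<times> sphere 0 1\<close> takes the place of the continuity of parameter
  integrals.\<close>

lemma continuous_on_circle_norm:
  fixes G :: "complex \<Rightarrow> complex \<Rightarrow> real"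
  assumes cont: "continuous_on (S \<times> sphere 0 1) (\<lambda>(b, w). G b w)" and S: "compact S" and q: "1 \<le> q"
  shows "continuous_on S (\<lambda>b. circle_norm q (G b))"
proof (cases q rule: ennreal_cases)
  case (real Q)
  then have Q: "Q \<ge> 1" using q by simp
  have cQ: "continuous_on (S \<times> sphere 0 1) (\<lambda>(b, w). \<bar>G b w\<bar> powr Q)"
    using continuous_on_abs_powr[OF cont, of Q] Q by (simp add: split_beta)
  have cQw: "continuous_on (sphere 0 1) (\<lambda>w. \<bar>G b w\<bar> powr Q)" if "b \<in> S" for b
    by (rule continuous_on_compose2[OF cQ, where f = "\<lambda>w. (b, w)", simplified])
      (use that in \<open>auto intro!: continuous_intros\<close>)
  have "continuous_on S (\<lambda>b. circle_int (\<lambda>w. \<bar>G b w\<bar> powr Q) powr (1 / Q))"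
    using Q cQw by (intro continuous_on_powr' circle_int_continuous_on[OF cQ] continuous_intros)
      (auto intro!: circle_int_nonneg)
  then show ?thesis using real Q by (simp add: circle_norm_real)
next
  case top
  have cw: "continuous_on (sphere 0 1) (G b)" if "b \<in> S" for b
    by (rule continuous_on_compose2[OF cont, where f = "\<lambda>w. (b, w)", simplified])
      (use that in \<open>auto intro!: continuous_intros\<close>)
  have unif: "uniformly_continuous_on (S \<times> sphere 0 1) (\<lambda>(b, w). G b w)"
    by (intro compact_uniformly_continuous cont compact_Times S compact_sphere)
  show ?thesis unfolding continuous_on_iff
  proof (intro ballI allI impI)
    fix b e assume b: "b \<in> S" and e: "(0 :: real) < e"
    then have "0 < e / 2" by simp
    then obtain d where d: "d > 0"
      "\<And>x y. x \<in> S \<times> sphere 0 1 \<Longrightarrow> y \<in> S \<times> sphere 0 1 \<Longrightarrow> dist y x < d \<Longrightarrow>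
        dist (case y of (b, w) \<Rightarrow> G b w) (case x of (b, w) \<Rightarrow> G b w) < e / 2"
      using unif unfolding uniformly_continuous_on_def by metis
    have le: "circle_norm \<infinity> (G b1) \<le> circle_norm \<infinity> (G b2) + e / 2"
      if "b1 \<in> S" "b2 \<in> S" "dist b1 b2 < d" for b1 b2
    proof (rule circle_norm_top_le)
      fix w :: complex assume w: "w \<in> sphere 0 1"
      have "\<bar>G b1 w - G b2 w\<bar> < e / 2"
        using d(2)[of "(b2, w)" "(b1, w)"] that w by (simp add: dist_Pair_Pair dist_real_def)
      then show "\<bar>G b1 w\<bar> \<le> circle_norm \<infinity> (G b2) + e / 2"
        using abs_le_circle_norm_top[OF cw[OF that(2)] w] by linarith
    qed
    have "dist (circle_norm q (G b')) (circle_norm q (G b)) < e" if "b' \<in> S" "dist b' b < d" for b'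
    proof -
      have "circle_norm \<infinity> (G b') \<le> circle_norm \<infinity> (G b) + e / 2" "circle_norm \<infinity> (G b) \<le> circle_norm \<infinity> (G b') + e / 2"
        using le[of b' b] le[of b b'] that b by (simp_all add: dist_commute)
      then show ?thesis using e top by (simp add: dist_real_def)
    qed
    then show "\<exists>d>0. \<forall>b'\<in>S. dist b' b < d \<longrightarrow> dist (circle_norm q (G b')) (circle_norm q (G b)) < e"
      using d(1) by blast
  qed
qed

lemma continuous_on_disc_kernel_circle:
  assumes "1 \<le> q"
  shows "continuous_on (sphere 0 1) (disc_kernel q n \<theta> b)"
  using continuous_on_compose2[OF continuous_on_disc_kernel[OF assms, of UNIV n \<theta>], of "sphere 0 1" "\<lambda>w. (b, w)"]
  by (simp add: continuous_on_Pair)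

text \<open>Rotating \<open>w\<close> to \<open>cis \<tau> * w\<close> moves the parameter to
  \<open>1\<close>, and the factor \<open>cnj w ^ n\<close> turns the rotation into a phase shift by
  \<open>n * \<tau>\<close>.\<close>

lemma circle_norm_disc_kernel_rotate:
  assumes q: "1 \<le> q"
  shows "circle_norm q (disc_kernel q n \<theta> (cis \<tau>)) = circle_norm q (disc_kernel q n (\<theta> + real n * \<tau>) 1)"
proof -
  have "disc_kernel q n \<theta> (cis \<tau>) w = disc_kernel q n (\<theta> + real n * \<tau>) 1 (cis \<tau> * w)" for w
  proof -
    have "cis (\<theta> + real n * \<tau>) * cnj (cis \<tau> * w) ^ n = cis \<theta> * cnj w ^ n"
      by (simp add: power_mult_distrib cis_cnj Complex.DeMoivre cis_mult mult.assoc[symmetric])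
    then show ?thesis by (simp add: disc_kernel_def del: complex_cnj_mult)
  qed
  then have "circle_norm q (disc_kernel q n \<theta> (cis \<tau>)) = circle_norm q (\<lambda>w. disc_kernel q n (\<theta> + real n * \<tau>) 1 (cis \<tau> * w))"
    by (intro circle_norm_cong) simp
  also have "\<dots> = circle_norm q (disc_kernel q n (\<theta> + real n * \<tau>) 1)"
    by (intro circle_norm_rotate continuous_on_disc_kernel_circle q) simp
  finally show ?thesis .
qed

lemma circle_norm_disc_kernel_even:
  assumes q: "1 \<le> q"
  shows "circle_norm q (disc_kernel q n (- \<theta>) 1) = circle_norm q (disc_kernel q n \<theta> 1)"
proof -
  have "disc_kernel q n (- \<theta>) 1 w = disc_kernel q n \<theta> 1 (cnj w)" for w
  proof -
    have "cnj (cis (- \<theta>) * cnj w ^ n * (1 + 1 * w) ^ (n - 1)) = cis \<theta> * cnj (cnj w) ^ n * (1 + 1 * cnj w) ^ (n - 1)"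
      by (simp add: cis_cnj)
    then have "Re (cis (- \<theta>) * cnj w ^ n * (1 + 1 * w) ^ (n - 1)) = Re (cis \<theta> * cnj (cnj w) ^ n * (1 + 1 * cnj w) ^ (n - 1))"
      by (metis cnj.simps(1))
    moreover have "cmod (1 + 1 * w) = cmod (1 + 1 * cnj w)"
      by (metis complex_cnj_add complex_cnj_mult complex_cnj_one complex_mod_cnj)
    ultimately show ?thesis by (simp only: disc_kernel_def)
  qed
  then have "circle_norm q (disc_kernel q n (- \<theta>) 1) = circle_norm q (\<lambda>w. disc_kernel q n \<theta> 1 (cnj w))"
    by (intro circle_norm_cong) simp
  also have "\<dots> = circle_norm q (disc_kernel q n \<theta> 1)"
    by (intro circle_norm_cnj continuous_on_disc_kernel_circle q)
  finally show ?thesis .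
qed

lemma circle_norm_disc_kernel_period:
  "circle_norm q (disc_kernel q n (\<theta> + of_int k * pi) b) = circle_norm q (disc_kernel q n \<theta> b)"
proof (rule circle_norm_cong)
  fix w
  define \<epsilon> :: real where "\<epsilon> = (if even k then 1 else -1)"
  have "cis (\<theta> + of_int k * pi) = of_real \<epsilon> * cis \<theta>"
    by (rule complex_eqI) (simp_all add: cos_add sin_add mult.commute[of "of_int k"] cos_npi_int sin_npi_int \<epsilon>_def)
  then have "Re (cis (\<theta> + of_int k * pi) * cnj w ^ n * (1 + b * w) ^ (n - 1)) = \<epsilon> * Re (cis \<theta> * cnj w ^ n * (1 + b * w) ^ (n - 1))"
    by (simp add: mult.assoc \<epsilon>_def)
  then show "\<bar>disc_kernel q n (\<theta> + of_int k * pi) b w\<bar> = \<bar>disc_kernel q n \<theta> b w\<bar>"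
    by (simp add: disc_kernel_def abs_mult \<epsilon>_def)
qed

text \<open>In the phase the norm is even and has period \<open>pi\<close>, so
  \<open>{0..pi / 2}\<close> represents all phases; hence the range of \<open>\<beta>\<close> in the
  constant.\<close>

lemma circle_norm_disc_kernel_reduce:
  assumes q: "1 \<le> q"
  obtains \<beta> where "\<beta> \<in> {0..pi / 2}"
    "circle_norm q (disc_kernel q n \<theta> 1) = circle_norm q (disc_kernel q n (- \<beta>) 1)"
proof -
  define k where "k = \<lfloor>\<theta> / pi\<rfloor>"
  define \<theta>0 where "\<theta>0 = \<theta> - of_int k * pi"
  have "of_int k \<le> \<theta> / pi" "\<theta> / pi < of_int k + 1" by (simp_all add: k_def)
  then have \<theta>0: "0 \<le> \<theta>0" "\<theta>0 < pi" by (simp_all add: \<theta>0_def field_simps)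
  have eq: "circle_norm q (disc_kernel q n \<theta> 1) = circle_norm q (disc_kernel q n \<theta>0 1)"
    using circle_norm_disc_kernel_period[of q n \<theta>0 k 1] by (simp add: \<theta>0_def)
  show ?thesis
  proof (cases "\<theta>0 \<le> pi / 2")
    case True
    then show ?thesis using that[of \<theta>0] eq \<theta>0 circle_norm_disc_kernel_even[OF q] by simp
  next
    case False
    then show ?thesis
      using that[of "pi - \<theta>0"] eq \<theta>0 circle_norm_disc_kernel_period[of q n \<theta>0 "- 1" 1] by simp
  qed
qed

text \<open>The substitution \<open>w = cis (2 v - pi)\<close> turns \<open>1 + w\<close> into \<open>2 sin v cis (v - pi / 2)\<close>.\<close>

lemma abs_disc_kernel_one:
  assumes n: "1 \<le> n" and v: "v \<in> {0..pi}"
  shows "\<bar>disc_kernel q n (- \<beta>) 1 (cis (2 * v - pi))\<bar>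
    = pow_weight (2 - 2 * enn2real (1 / q)) (2 * sin v) * (2 * sin v) ^ (n - 1)
      * \<bar>cos (v * real (n + 1) + \<beta> - pi / 2 * (real n - 1))\<bar>"
proof -
  have s: "sin v \<ge> 0" using v by (auto intro: sin_ge_zero)
  have d: "1 + cis (2 * v - pi) = of_real (2 * sin v) * cis (v - pi / 2)"
    by (rule complex_eqI) (simp_all add: cos_diff sin_diff cos_double_sin sin_double power2_eq_square)
  let ?X = "v * real (n + 1) + \<beta> - pi / 2 * (real n - 1)"
  have "cis (- \<beta>) * cnj (cis (2 * v - pi)) ^ n * cis (v - pi / 2) ^ (n - 1)
      = cis (- \<beta> + real n * (pi - 2 * v) + real (n - 1) * (v - pi / 2))"
    by (simp add: cis_cnj Complex.DeMoivre cis_mult)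
  also have "- \<beta> + real n * (pi - 2 * v) + real (n - 1) * (v - pi / 2) = pi - ?X"
    using n by (simp add: of_nat_diff field_simps)
  finally have "Re (cis (- \<beta>) * cnj (cis (2 * v - pi)) ^ n * cis (v - pi / 2) ^ (n - 1)) = - cos ?X"
    by (simp add: cos_diff)
  moreover have "cis (- \<beta>) * cnj (cis (2 * v - pi)) ^ n * (1 + 1 * cis (2 * v - pi)) ^ (n - 1)
     = of_real ((2 * sin v) ^ (n - 1)) * (cis (- \<beta>) * cnj (cis (2 * v - pi)) ^ n * cis (v - pi / 2) ^ (n - 1))"
  proof -
    have "A * B * (of_real x * C) ^ m = of_real (x ^ m) * (A * B * C ^ m)" for A B C :: complex and x m
      by (simp add: power_mult_distrib)
    then show ?thesis unfolding mult_1 d .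
  qed
  moreover have "Re (of_real x * y) = x * Re y" for x y by simp
  ultimately have "Re (cis (- \<beta>) * cnj (cis (2 * v - pi)) ^ n * (1 + 1 * cis (2 * v - pi)) ^ (n - 1)) = (2 * sin v) ^ (n - 1) * - cos ?X"
    by (simp only:)
  moreover have "cmod (1 + 1 * cis (2 * v - pi)) = 2 * sin v"
    unfolding mult_1 d using s by (simp add: norm_mult)
  ultimately show ?thesis
    using s unfolding disc_kernel_def by (simp add: abs_mult)
qed

text \<open>Of the factor \<open>2 powr (n + 1 - 1/q)\<close>, the powers of
  \<open>2 * sin v\<close> give the exponent \<open>n + 1 - 2/q\<close>, and the Jacobian
  \<open>2\<close> of \<open>t = 2 * v - pi\<close> gives \<open>1/q\<close>.\<close>

lemma circle_norm_disc_kernel_one: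
  assumes q: "1 \<le> q" and n: "1 \<le> n"
  shows "circle_norm q (disc_kernel q n (- \<beta>) 1) = 2 powr (real n + 1 - enn2real (1 / q)) * F_root q n \<beta>"
proof (cases q rule: ennreal_cases)
  case top
  let ?A = "\<lambda>v. \<bar>sin v ^ (n + 1) * cos (v * real (n + 1) + \<beta> - pi / 2 * (real n - 1))\<bar>"
  have c: "continuous_on (sphere 0 1) (disc_kernel q n (- \<beta>) 1)"
    by (rule continuous_on_disc_kernel_circle[OF q])
  have eq: "\<bar>disc_kernel q n (- \<beta>) 1 (cis (2 * v - pi))\<bar> = 2 ^ (n + 1) * ?A v" if "v \<in> {0..pi}" for v
  proof -
    have s: "sin v \<ge> 0" using that by (auto intro: sin_ge_zero)
    have "pow_weight 2 (2 * sin v) * (2 * sin v) ^ (n - 1) = (2 * sin v) ^ (n + 1)"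
      using n s by (cases n) (simp_all add: pow_weight_def power2_eq_square)
    then show ?thesis using s unfolding abs_disc_kernel_one[OF n that]
      by (simp add: top abs_mult power_mult_distrib del: power_Suc)
  qed
  have F: "F_root q n \<beta> = (SUP v\<in>{0..pi}. ?A v)" using top by (simp add: F_root_def)
  have le1: "?A v \<le> 1" for v
    unfolding abs_mult power_abs by (intro mult_le_one power_le_one) auto
  have bdd: "bdd_above (?A ` {0..pi})" using le1 by (intro bdd_aboveI[of _ 1]) auto
  have "circle_norm \<infinity> (disc_kernel q n (- \<beta>) 1) \<le> 2 ^ (n + 1) * F_root q n \<beta>"
  proof (rule circle_norm_top_le)
    fix w :: complex assume w: "w \<in> sphere 0 1"
    define v where "v = (Arg w + pi) / 2"
    have "2 * v - pi = Arg w" by (simp add: v_def field_simps)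
    then have v: "v \<in> {0..pi}" "w = cis (2 * v - pi)"
      using mpi_less_Arg[of w] Arg_le_pi[of w] w rcis_cmod_Arg[of w] by (auto simp: v_def rcis_def)
    have "?A v \<le> F_root q n \<beta>" unfolding F using bdd v(1) by (intro cSUP_upper)
    then show "\<bar>disc_kernel q n (- \<beta>) 1 w\<bar> \<le> 2 ^ (n + 1) * F_root q n \<beta>"
      unfolding v(2) eq[OF v(1)] by (intro mult_left_mono) auto
  qed
  moreover have "F_root q n \<beta> \<le> circle_norm \<infinity> (disc_kernel q n (- \<beta>) 1) / 2 ^ (n + 1)"
    unfolding F
  proof (rule cSUP_least)
    fix v :: real assume v: "v \<in> {0..pi}"
    have "2 ^ (n + 1) * ?A v \<le> circle_norm \<infinity> (disc_kernel q n (- \<beta>) 1)"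
      unfolding eq[OF v, symmetric] by (intro abs_le_circle_norm_top[OF c]) simp
    then show "?A v \<le> circle_norm \<infinity> (disc_kernel q n (- \<beta>) 1) / 2 ^ (n + 1)"
      by (simp add: field_simps)
  qed auto
  moreover have "(2 :: real) powr (real n + 1) = 2 ^ (n + 1)"
    by (simp add: powr_add powr_realpow)
  ultimately show ?thesis using top by (simp add: field_simps)
next
  case (real Q)
  then have Q: "Q \<ge> 1" using q by simp
  have q': "enn2real (1 / q) = 1 / Q" using real Q divide_ennreal[of 1 Q] by simp
  let ?h = "\<lambda>w. \<bar>disc_kernel q n (- \<beta>) 1 w\<bar> powr Q"
  let ?f = "\<lambda>v. \<bar>sin v powr (real (n + 1) - 2 / Q) * cos (v * real (n + 1) + \<beta> - pi / 2 * (real n - 1))\<bar> powr Q"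
  have c: "continuous_on (sphere 0 1) ?h"
    using Q continuous_on_disc_kernel_circle[OF q] by (intro continuous_on_abs_powr) auto
  have eq: "?h (cis (2 * v - pi)) = 2 powr ((real n + 1) * Q - 2) * ?f v" if "v \<in> {0..pi} - {0, pi}" for v
  proof -
    have v: "v \<in> {0..pi}" and s: "sin v > 0" using that by (auto intro: sin_gt_zero)
    have "pow_weight (2 - 2 / Q) (2 * sin v) * (2 * sin v) ^ (n - 1) = (2 * sin v) powr (2 - 2 / Q + real (n - 1))"
      using s by (simp add: pow_weight_pos powr_add powr_realpow)
    also have "2 - 2 / Q + real (n - 1) = real (n + 1) - 2 / Q" using n by (simp add: of_nat_diff)
    finally have "\<bar>disc_kernel q n (- \<beta>) 1 (cis (2 * v - pi))\<bar> = 2 powr (real (n + 1) - 2 / Q)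
        * \<bar>sin v powr (real (n + 1) - 2 / Q) * cos (v * real (n + 1) + \<beta> - pi / 2 * (real n - 1))\<bar>"
      using s unfolding abs_disc_kernel_one[OF n v] q' by (simp add: powr_mult abs_mult)
    moreover have "(real (n + 1) - 2 / Q) * Q = (real n + 1) * Q - 2" using Q by (simp add: field_simps)
    ultimately show ?thesis by (simp add: powr_mult powr_powr)
  qed
  have "((\<lambda>v. 2 *\<^sub>R ?h (cis (2 * v - pi))) has_integral integral {2 * 0 - pi..2 * pi - pi} (\<lambda>t. ?h (cis t))) {0..pi}"
    by (rule has_integral_substitution[where c = "- pi" and d = pi])
      (use continuous_on_circle_param[OF c, of _ 0] in \<open>auto intro!: derivative_eq_intros\<close>)
  moreover have "integral {2 * 0 - pi..2 * pi - pi} (\<lambda>t. ?h (cis t)) = circle_int ?h"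
    using circle_int_shift[OF c, of "- pi"] by simp
  ultimately have "((\<lambda>v. 2 * ?h (cis (2 * v - pi))) has_integral circle_int ?h) {0..pi}"
    by simp
  then have "circle_int ?h = integral {0..pi} (\<lambda>v. 2 * ?h (cis (2 * v - pi)))"
    by (rule integral_unique[symmetric])
  \<comment> \<open>The endpoints are left out because \<open>0 powr 0 = 0\<close>: for
    \<open>n = 1\<close> and \<open>q = 1\<close> the two integrands can differ there.\<close>
  also have "\<dots> = integral {0..pi} (\<lambda>v. 2 * (2 powr ((real n + 1) * Q - 2) * ?f v))"
    by (rule integral_spike[of "{0, pi}"]) (use eq in auto)
  also have "\<dots> = 2 * 2 powr ((real n + 1) * Q - 2) * F Q n \<beta>"
    by (simp add: F_def)
  also have "2 * 2 powr ((real n + 1) * Q - 2) = (2 :: real) powr ((real n + 1) * Q - 1)"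
    using powr_mult_base[of 2 "(real n + 1) * Q - 2"] by (simp add: algebra_simps)
  finally have "circle_norm q (disc_kernel q n (- \<beta>) 1) = (2 powr ((real n + 1) * Q - 1) * F Q n \<beta>) powr (1 / Q)"
    using real Q by (simp add: circle_norm_real)
  also have "\<dots> = 2 powr (((real n + 1) * Q - 1) / Q) * F_root q n \<beta>"
    using real Q by (simp add: F_root_def powr_mult powr_powr)
  also have "((real n + 1) * Q - 1) / Q = real n + 1 - enn2real (1 / q)"
    using Q q' by (simp add: field_simps)
  finally show ?thesis .
qed

text \<open>The phase \<open>- \<beta>\<close> at the parameter \<open>1\<close> is the phase
  \<open>0\<close> at the parameter \<open>cis (- \<beta> / n)\<close>, so continuity of
  \<open>F_root\<close> in \<open>\<beta>\<close> comes from continuity of the norm in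
  \<open>b\<close>.\<close>

lemma F_root_attains_max:
  assumes q: "1 \<le> q" and n: "1 \<le> n"
  shows "\<exists>\<beta>\<in>{0..pi / 2}. \<forall>\<beta>'\<in>{0..pi / 2}. F_root q n \<beta>' \<le> F_root q n \<beta>"
proof -
  define e where "e = real n + 1 - enn2real (1 / q)"
  have "F_root q n \<beta> = 2 powr - e * circle_norm q (disc_kernel q n 0 (cis (- \<beta> / real n)))" for \<beta>
    using circle_norm_disc_kernel_rotate[OF q, of n 0 "- \<beta> / real n"] circle_norm_disc_kernel_one[OF q n, of \<beta>] n
    unfolding e_def[symmetric] by (simp add: powr_minus)
  moreover have "continuous_on {0..pi / 2} (\<lambda>\<beta>. circle_norm q (disc_kernel q n 0 (cis (- \<beta> / real n))))"
    by (rule continuous_on_compose2[OF continuous_on_circle_norm[OF continuous_on_disc_kernel[OF q] compact_sphere[of 0 1] q]])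
      (use n in \<open>auto intro!: continuous_intros\<close>)
  ultimately have "continuous_on {0..pi / 2} (F_root q n)"
    by (simp add: continuous_on_mult)
  then show ?thesis
    using continuous_attains_sup[of "{0..pi / 2}" "F_root q n"] by auto
qed

text \<open>The maximum principle leads to \<open>cmod b = 1\<close>, a rotation to
  \<open>b = 1\<close>, and the symmetries in the phase to \<open>{0..pi / 2}\<close>.\<close>

lemma circle_norm_disc_kernel_le:
  assumes q: "1 \<le> q" and n: "1 \<le> n" and b: "b \<in> cball 0 1"
  shows "circle_norm q (disc_kernel q n \<theta> b)
    \<le> 2 powr (real n + 1 - enn2real (1 / q)) * (SUP \<beta>\<in>{0..pi / 2}. F_root q n \<beta>)"
proof (rule disc_kernel_max_principle[OF q _ b])
  fix b :: complex assume b: "b \<in> sphere 0 1"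
  then have "b = cis (Arg b)" using rcis_cmod_Arg[of b] by (simp add: rcis_def)
  then have "circle_norm q (disc_kernel q n \<theta> b) = circle_norm q (disc_kernel q n (\<theta> + real n * Arg b) 1)"
    using circle_norm_disc_kernel_rotate[OF q, of n \<theta> "Arg b"] by simp
  moreover obtain \<beta> where \<beta>: "\<beta> \<in> {0..pi / 2}"
    "circle_norm q (disc_kernel q n (\<theta> + real n * Arg b) 1) = circle_norm q (disc_kernel q n (- \<beta>) 1)"
    using circle_norm_disc_kernel_reduce[OF q] by blast
  moreover have "F_root q n \<beta> \<le> (SUP \<beta>\<in>{0..pi / 2}. F_root q n \<beta>)"
    using F_root_attains_max[OF q n] \<beta>(1) by (intro cSUP_upper) (auto intro: bdd_aboveI)
  ultimately show "circle_norm q (disc_kernel q n \<theta> b)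
      \<le> 2 powr (real n + 1 - enn2real (1 / q)) * (SUP \<beta>\<in>{0..pi / 2}. F_root q n \<beta>)"
    using circle_norm_disc_kernel_one[OF q n] by simp
qed

section \<open>The upper bound\<close>

lemma conjugate_exponents_enn2real:
  fixes p q :: ennreal
  assumes "1 \<le> p" "1 / p + 1 / q = 1"
  shows "enn2real (1 / q) - 1 = - enn2real (1 / p)" "1 \<le> q"
proof -
  have "enn2real (1 / q) - 1 = - enn2real (1 / p) \<and> 1 \<le> q"
    using assms
  proof (cases rule: conjugate_exponents_cases)
    case (mid P Q)
    then show ?thesis using divide_ennreal[of 1 P] divide_ennreal[of 1 Q] by simp
  qed simp_all
  then show "enn2real (1 / q) - 1 = - enn2real (1 / p)" "1 \<le> q" by auto
qed

lemma higher_deriv_le_circle_norm: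
  assumes pq: "1 \<le> p" "1 / p + 1 / q = 1" and n: "1 \<le> n"
    and g: "g holomorphic_on ball 0 R" "1 < R" and z: "cmod z < 1"
  shows "cmod ((deriv ^^ n) g z)
    \<le> sharp_const q n * (1 - (cmod z)\<^sup>2) powr (- enn2real (1 / p) - real n) * circle_norm p (\<lambda>w. Re (g w))"
proof -
  note q = conjugate_exponents_enn2real[OF pq]
  define D where "D = (deriv ^^ n) g z"
  \<comment> \<open>This phase rotates \<open>D\<close> onto the nonnegative real axis.\<close>
  define \<theta> where "\<theta> = - Arg D"
  define s where "s = (1 - (cmod z)\<^sup>2) powr (- enn2real (1 / p) - real n)"
  have "g holomorphic_on sphere 0 1"
    using g(2) by (intro holomorphic_on_subset[OF g(1)]) auto
  then have cont: "continuous_on (sphere 0 1) (\<lambda>w. Re (g w))"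
    by (intro continuous_intros holomorphic_on_imp_continuous_on)
  have "cis \<theta> * D = of_real (cmod D)"
  proof -
    have "D = of_real (cmod D) * cis (Arg D)" using rcis_cmod_Arg[of D] by (simp add: rcis_def)
    then have "cis \<theta> * D = of_real (cmod D) * (cis \<theta> * cis (Arg D))" by (metis mult.left_commute)
    then show ?thesis by (simp add: cis_mult \<theta>_def)
  qed
  then have D: "cmod D = Re (cis \<theta> * D)" by simp
  have "circle_norm q (deriv_kernel n \<theta> z) = s * circle_norm q (disc_kernel q n \<theta> (cnj z))"
  proof -
    have e: "enn2real (1 / q) - real n - 1 = - enn2real (1 / p) - real n" using q(1) by linarith
    show ?thesis using circle_norm_deriv_kernel[OF q(2) z n, of \<theta>] unfolding e s_def .
  qed
  also have "\<dots> \<le> s * (2 powr (real n + 1 - enn2real (1 / q)) * (SUP \<beta>\<in>{0..pi / 2}. F_root q n \<beta>))"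
    using z by (intro mult_left_mono circle_norm_disc_kernel_le q(2) n) (auto simp: s_def)
  finally have kern: "circle_norm q (deriv_kernel n \<theta> z) \<le> \<dots>" .
  note D
  also have "Re (cis \<theta> * D) = fact n / pi * circle_int (\<lambda>w. Re (g w) * deriv_kernel n \<theta> z w)"
    unfolding D_def by (rule Re_higher_deriv_eq_circle_int[OF g n z])
  also have "\<dots> \<le> fact n / pi * (circle_norm p (\<lambda>w. Re (g w)) * circle_norm q (deriv_kernel n \<theta> z))"
    using circle_hoelder[OF pq cont continuous_on_deriv_kernel[OF z, of n \<theta>]]
    by (intro mult_left_mono) auto
  also have "\<dots> \<le> fact n / pi * (circle_norm p (\<lambda>w. Re (g w)) *
      (s * (2 powr (real n + 1 - enn2real (1 / q)) * (SUP \<beta>\<in>{0..pi / 2}. F_root q n \<beta>))))"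
    by (intro mult_left_mono kern circle_norm_nonneg cont) auto
  finally have "cmod D \<le> \<dots>" .
  then show ?thesis unfolding D_def[symmetric] s_def[symmetric] sharp_const_def by (simp add: mult_ac)
qed

section \<open>From norms on the circle to norms on the disc\<close>

text \<open>The growth half of membership in \<open>hp\<close>; it makes the suprema in
  \<open>hp_norm\<close> genuine upper bounds.\<close>

definition hp_bounded :: "ennreal \<Rightarrow> (complex \<Rightarrow> real) \<Rightarrow> bool" where
  "hp_bounded p u \<longleftrightarrow> (if p = \<infinity> then bdd_above ((\<lambda>z. \<bar>u z\<bar>) ` ball 0 1)
      else bdd_above (circle_integral (enn2real p) u ` {0<..<1}))"

lemma circle_integral_eq: "circle_integral P u r = circle_int (\<lambda>w. \<bar>u (of_real r * w)\<bar> powr P)"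
  by (simp add: circle_integral_def circle_int_def)

lemma continuous_on_dilation:
  fixes u :: "complex \<Rightarrow> real"
  assumes "continuous_on (ball 0 1) u" "0 < r" "r < 1"
  shows "continuous_on (sphere 0 1) (\<lambda>w. u (of_real r * w))"
  by (rule continuous_on_compose2[OF assms(1)]) (use assms in \<open>auto simp: norm_mult intro!: continuous_intros\<close>)

lemma circle_norm_dilation_le_hp_norm:
  assumes p: "1 \<le> p" and u: "continuous_on (ball 0 1) u" "hp_bounded p u" and r: "0 < r" "r < 1"
  shows "circle_norm p (\<lambda>w. u (of_real r * w)) \<le> hp_norm p u"
proof (cases p rule: ennreal_cases)
  case top
  have "circle_norm \<infinity> (\<lambda>w. u (of_real r * w)) \<le> hp_norm p u"
  proof (rule circle_norm_top_le)
    fix w :: complex assume "w \<in> sphere 0 1"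
    then have "of_real r * w \<in> ball 0 1" using r by (simp add: norm_mult)
    then show "\<bar>u (of_real r * w)\<bar> \<le> hp_norm p u"
      using u(2) top unfolding hp_norm_def hp_bounded_def by (auto intro: cSUP_upper)
  qed
  then show ?thesis using top by simp
next
  case (real P)
  then have P: "P \<ge> 1" using p by simp
  have "circle_integral P u r \<le> (SUP r\<in>{0<..<1}. circle_integral P u r)"
    using u(2) real P r by (intro cSUP_upper) (auto simp: hp_bounded_def)
  moreover have "0 \<le> circle_integral P u r"
    unfolding circle_integral_eq using P
    by (intro circle_int_nonneg continuous_on_abs_powr continuous_on_dilation u r) auto
  ultimately show ?thesis
    using real P by (auto simp: circle_norm_real hp_norm_def circle_integral_eq intro!: powr_mono2)
qed

lemma powr_abs_diff_le:
  fixes a b :: real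
  assumes "1 \<le> P"
  shows "\<bar>a - b\<bar> powr P \<le> 2 powr P * (\<bar>a\<bar> powr P + \<bar>b\<bar> powr P)"
proof -
  have "\<bar>a - b\<bar> powr P \<le> (2 * max \<bar>a\<bar> \<bar>b\<bar>) powr P"
    using assms by (intro powr_mono2) auto
  also have "\<dots> = 2 powr P * max \<bar>a\<bar> \<bar>b\<bar> powr P" by (simp add: powr_mult)
  also have "\<dots> \<le> 2 powr P * (\<bar>a\<bar> powr P + \<bar>b\<bar> powr P)"
    by (intro mult_left_mono) (auto simp: max_def)
  finally show ?thesis .
qed

text \<open>Ensures that the supremum in \<open>hp_norm\<close> of \<open>Re (f - P)\<close> is
  finite, the real part of a polynomial being bounded on the disc.\<close>

lemma hp_bounded_diff:
  assumes p: "1 \<le> p" and u: "continuous_on (ball 0 1) u" "hp_bounded p u"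
    and v: "continuous_on (ball 0 1) v" "\<And>z. z \<in> ball 0 1 \<Longrightarrow> \<bar>v z\<bar> \<le> B"
  shows "hp_bounded p (\<lambda>z. u z - v z)"
proof (cases p rule: ennreal_cases)
  case top
  then have "\<exists>A. \<forall>z\<in>ball 0 1. \<bar>u z\<bar> \<le> A"
    using u(2) by (simp add: hp_bounded_def bdd_above_def)
  then obtain A where A: "\<And>z. z \<in> ball 0 1 \<Longrightarrow> \<bar>u z\<bar> \<le> A" by blast
  have "bdd_above ((\<lambda>z. \<bar>u z - v z\<bar>) ` ball 0 1)"
  proof (rule bdd_aboveI2)
    fix z :: complex assume "z \<in> ball 0 1"
    then show "\<bar>u z - v z\<bar> \<le> A + B" using A[of z] v(2)[of z] by linarith
  qed
  then show ?thesis using top by (simp add: hp_bounded_def)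
next
  case (real P)
  then have P: "P \<ge> 1" using p by simp
  have "\<exists>A. \<forall>r\<in>{0<..<1}. circle_integral P u r \<le> A"
    using u(2) real P by (simp add: hp_bounded_def bdd_above_def)
  then obtain A where A: "\<And>r. r \<in> {0<..<1} \<Longrightarrow> circle_integral P u r \<le> A" by blast
  have "bdd_above (circle_integral P (\<lambda>z. u z - v z) ` {0<..<1})"
  proof (rule bdd_aboveI2)
    fix r :: real assume r: "r \<in> {0<..<1}"
    have cu: "continuous_on (sphere 0 1) (\<lambda>w. u (of_real r * w))"
      using r by (intro continuous_on_dilation u) auto
    have cv: "continuous_on (sphere 0 1) (\<lambda>w. v (of_real r * w))"
      using r by (intro continuous_on_dilation v) auto
    have cup: "continuous_on (sphere 0 1) (\<lambda>w. \<bar>u (of_real r * w)\<bar> powr P)"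
      using P by (intro continuous_on_abs_powr cu) auto
    have "circle_integral P (\<lambda>z. u z - v z) r
        \<le> circle_int (\<lambda>w. 2 powr P * (\<bar>u (of_real r * w)\<bar> powr P + B powr P))"
      unfolding circle_integral_eq
    proof (rule circle_int_mono)
      show "continuous_on (sphere 0 1) (\<lambda>w. \<bar>u (of_real r * w) - v (of_real r * w)\<bar> powr P)"
        using P by (intro continuous_on_abs_powr continuous_on_diff cu cv) auto
      show "continuous_on (sphere 0 1) (\<lambda>w. 2 powr P * (\<bar>u (of_real r * w)\<bar> powr P + B powr P))"
        by (intro continuous_on_mult continuous_on_add continuous_on_const cup)
      fix w :: complex assume "w \<in> sphere 0 1"
      then have "\<bar>v (of_real r * w)\<bar> \<le> B" using r by (intro v(2)) (auto simp: norm_mult)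
      then have "\<bar>v (of_real r * w)\<bar> powr P \<le> B powr P" using P by (intro powr_mono2) auto
      then have "2 powr P * (\<bar>u (of_real r * w)\<bar> powr P + \<bar>v (of_real r * w)\<bar> powr P)
          \<le> 2 powr P * (\<bar>u (of_real r * w)\<bar> powr P + B powr P)" by (intro mult_left_mono) auto
      then show "\<bar>u (of_real r * w) - v (of_real r * w)\<bar> powr P \<le> 2 powr P * (\<bar>u (of_real r * w)\<bar> powr P + B powr P)"
        using powr_abs_diff_le[OF P] order_trans by blast
    qed
    also have "\<dots> = 2 powr P * (circle_integral P u r + 2 * pi * B powr P)"
      by (simp only: circle_int_cmult circle_int_add[OF cup continuous_on_const] circle_int_const circle_integral_eq real_scaleR_def)
    also have "\<dots> \<le> 2 powr P * (A + 2 * pi * B powr P)"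
      using A[OF r] by (intro mult_left_mono) auto
    finally show "circle_integral P (\<lambda>z. u z - v z) r \<le> 2 powr P * (A + 2 * pi * B powr P)" .
  qed
  then show ?thesis using real P by (simp add: hp_bounded_def)
qed

lemma sharp_const_nonneg:
  assumes "1 \<le> q" "1 \<le> n"
  shows "0 \<le> sharp_const q n"
proof -
  have "0 \<le> circle_norm q (disc_kernel q n 0 1)"
    by (intro circle_norm_nonneg continuous_on_disc_kernel_circle assms)
  also have "\<dots> \<le> 2 powr (real n + 1 - enn2real (1 / q)) * (SUP \<beta>\<in>{0..pi / 2}. F_root q n \<beta>)"
    by (intro circle_norm_disc_kernel_le assms) auto
  finally show ?thesis unfolding sharp_const_def by (simp add: mult.assoc)
qed

text \<open>The dilate \<open>f (r * w)\<close> is holomorphic on a disc of radius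
  \<open>1 / r > 1\<close>, so the bound on the circle applies to it, and its circle norm is at most
  the norm of \<open>Re f\<close>. Continuity of the derivative allows \<open>r\<close> to tend to
  \<open>1\<close>.\<close>

lemma higher_deriv_le_hp_norm:
  assumes pq: "1 \<le> p" "1 / p + 1 / q = 1" and n: "1 \<le> n"
    and f: "f holomorphic_on ball 0 1" "hp_bounded p (\<lambda>w. Re (f w))" and z: "cmod z < 1"
  shows "cmod ((deriv ^^ n) f z)
    \<le> sharp_const q n * (1 - (cmod z)\<^sup>2) powr (- enn2real (1 / p) - real n) * hp_norm p (\<lambda>w. Re (f w))"
    (is "_ \<le> ?C * ?s * ?N")
proof -
  have cont: "continuous_on (ball 0 1) (\<lambda>w. Re (f w))"
    using f(1) by (intro continuous_intros holomorphic_on_imp_continuous_on)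
  have C: "?C \<ge> 0" by (rule sharp_const_nonneg[OF conjugate_exponents_enn2real(2)[OF pq] n])
  have le: "cmod (of_real r ^ n * (deriv ^^ n) f (of_real r * z)) \<le> ?C * ?s * ?N" if r: "0 < r" "r < 1" for r
  proof -
    have in_disc: "of_real r * w \<in> ball 0 1" if "w \<in> ball 0 (1 / r)" for w :: complex
      using that r by (simp add: norm_mult field_simps)
    have "(\<lambda>w. f (of_real r * w)) holomorphic_on ball 0 (1 / r)"
      using in_disc by (intro holomorphic_on_compose_gen[OF _ f(1), unfolded o_def] holomorphic_intros) auto
    moreover have r1: "1 < 1 / r" using r by simp
    ultimately have "cmod ((deriv ^^ n) (\<lambda>w. f (of_real r * w)) z)
        \<le> ?C * ?s * circle_norm p (\<lambda>w. Re (f (of_real r * w)))"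
      using z by (intro higher_deriv_le_circle_norm pq n)
    also have "\<dots> \<le> ?C * ?s * ?N"
      using C circle_norm_dilation_le_hp_norm[OF pq(1) cont f(2) r] by (intro mult_left_mono) auto
    also have "(deriv ^^ n) (\<lambda>w. f (of_real r * w)) z = of_real r ^ n * (deriv ^^ n) f (of_real r * z)"
    proof (rule higher_deriv_compose_linear[OF f(1)])
      show "z \<in> ball 0 (1 / r)" using z r1 by simp
    qed (use in_disc in auto)
    finally show ?thesis .
  qed
  \<comment> \<open>The \<open>+ 2\<close> keeps \<open>R 0\<close> positive.\<close>
  define R where "R j = 1 - 1 / real (j + 2)" for j
  have R: "0 < R j" "R j < 1" for j by (auto simp: R_def)
  have R_lim: "R \<longlonglongrightarrow> 1"
    using tendsto_diff[OF tendsto_const LIMSEQ_ignore_initial_segment[OF LIMSEQ_inverse_real_of_nat, of 1], of 1]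
    by (simp add: R_def[abs_def] inverse_eq_divide algebra_simps)
  then have c: "(\<lambda>j. complex_of_real (R j)) \<longlonglongrightarrow> 1" using tendsto_of_real[OF R_lim] by simp
  have "isCont ((deriv ^^ n) f) z"
    using holomorphic_on_imp_continuous_on[OF holomorphic_higher_deriv[OF f(1), of n]] z
    by (simp add: continuous_on_eq_continuous_at)
  moreover have "(\<lambda>j. of_real (R j) * z) \<longlonglongrightarrow> z" using tendsto_mult[OF c tendsto_const[of z]] by simp
  ultimately have "(\<lambda>j. (deriv ^^ n) f (of_real (R j) * z)) \<longlonglongrightarrow> (deriv ^^ n) f z"
    by (rule isCont_tendsto_compose)
  from tendsto_norm[OF tendsto_mult[OF tendsto_power[OF c, of n] this]]
  have "(\<lambda>j. cmod (of_real (R j) ^ n * (deriv ^^ n) f (of_real (R j) * z))) \<longlonglongrightarrow> cmod ((deriv ^^ n) f z)"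
    by simp
  then show ?thesis using le[OF R] by (intro LIMSEQ_le_const2) auto
qed

section \<open>Subtraction of polynomials of degree below \<open>n\<close>\<close>

lemma higher_deriv_poly:
  fixes P :: "complex poly"
  shows "(deriv ^^ n) (poly P) = poly ((pderiv ^^ n) P)"
proof (induction n)
  case (Suc n)
  have "deriv (poly Q) = poly (pderiv Q)" for Q :: "complex poly"
    by (rule ext) (rule DERIV_imp_deriv, rule poly_DERIV)
  then show ?case using Suc by simp
qed simp

lemma higher_deriv_poly_eq_0:
  fixes P :: "complex poly"
  assumes "degree P < n"
  shows "(deriv ^^ n) (poly P) z = 0"
proof -
  have "(pderiv ^^ n) P = 0"
    by (rule poly_eqI) (use assms in \<open>simp add: coeff_higher_pderiv coeff_eq_0\<close>)
  then show ?thesis by (simp add: higher_deriv_poly)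
qed

lemma hp_bounded_if_hp: "u \<in> hp p \<Longrightarrow> hp_bounded p u"
  by (simp add: hp_def hp_bounded_def)

lemma poly_bounded_on_disc:
  fixes P :: "complex poly"
  obtains B where "\<And>z. z \<in> cball 0 1 \<Longrightarrow> cmod (poly P z) \<le> B"
proof -
  have "bounded (poly P ` cball 0 1)"
    by (intro compact_imp_bounded compact_continuous_image continuous_intros compact_cball)
  then have "\<exists>B. \<forall>z\<in>cball 0 1. cmod (poly P z) \<le> B" by (simp add: bounded_iff)
  then show ?thesis using that by blast
qed

text \<open>The \<open>n\<close>-th derivative of \<open>P\<close> vanishes, so the bound for
  \<open>f - P\<close> is one for \<open>f\<close>; \<open>degree P \<le> n - 1\<close> means
  \<open>degree P < n\<close> because \<open>n \<ge> 1\<close>.\<close>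

lemma higher_deriv_le_hp_norm_diff_poly:
  assumes pq: "1 \<le> p" "1 / p + 1 / q = 1" and n: "1 \<le> n"
    and f: "f holomorphic_on ball 0 1" "(\<lambda>w. Re (f w)) \<in> hp p"
    and P: "degree P \<le> n - 1" and z: "z \<in> ball 0 1"
  shows "cmod ((deriv ^^ n) f z)
    \<le> sharp_const q n * (1 - (cmod z)\<^sup>2) powr (- enn2real (1 / p) - real n) * hp_norm p (\<lambda>w. Re (f w - poly P w))"
proof -
  have holP: "poly P holomorphic_on ball 0 1" by (intro holomorphic_intros)
  obtain B where B: "\<And>z. z \<in> cball 0 1 \<Longrightarrow> cmod (poly P z) \<le> B" using poly_bounded_on_disc by blast
  have "hp_bounded p (\<lambda>w. Re (f w) - Re (poly P w))"
  proof (rule hp_bounded_diff[OF pq(1) _ hp_bounded_if_hp[OF f(2)]])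
    show "\<bar>Re (poly P z)\<bar> \<le> B" if "z \<in> ball 0 1" for z
      using B[of z] that abs_Re_le_cmod[of "poly P z"] by auto
  qed (intro continuous_intros holomorphic_on_imp_continuous_on f(1) holP)+
  then have "cmod ((deriv ^^ n) (\<lambda>w. f w - poly P w) z)
    \<le> sharp_const q n * (1 - (cmod z)\<^sup>2) powr (- enn2real (1 / p) - real n) * hp_norm p (\<lambda>w. Re (f w - poly P w))"
    using z by (intro higher_deriv_le_hp_norm pq n holomorphic_on_diff f(1) holP) auto
  moreover have "(deriv ^^ n) (\<lambda>w. f w - poly P w) z = (deriv ^^ n) f z - (deriv ^^ n) (poly P) z"
    by (rule higher_deriv_diff[OF f(1) holP _ z]) simp
  moreover have "(deriv ^^ n) (poly P) z = 0"
    using P n by (intro higher_deriv_poly_eq_0) auto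
  ultimately show ?thesis by simp
qed

section \<open>Sharpness\<close>

text \<open>On the circle \<open>w * cnj w = 1\<close> cancels mixed powers, and what remains in
  \<open>cnj w\<close> has the same real part as its conjugate. The recursion strips the lowest
  coefficient from both polynomials at once.\<close>

lemma Re_poly_mult_cnj_poly_circle:
  fixes P Q :: "complex poly"
  shows "\<exists>S. \<forall>w\<in>sphere 0 1. Re (poly P w * cnj (poly Q w)) = Re (poly S w)"
proof (induction Q arbitrary: P)
  case 0
  show ?case by (rule exI[of _ 0]) simp
next
  case (pCons a Q)
  obtain b P' where P: "P = pCons b P'" by (cases P)
  obtain S where S: "\<And>w. w \<in> sphere 0 1 \<Longrightarrow> Re (poly P' w * cnj (poly Q w)) = Re (poly S w)"
    using pCons.IH by blast
  show ?case
  proof (intro exI ballI)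
    fix w :: complex assume w: "w \<in> sphere 0 1"
    then have ww: "w * cnj w = 1" using complex_norm_square[of w] by simp
    have "poly P w * cnj (poly (pCons a Q) w)
        = cnj a * poly P w + b * (cnj w * cnj (poly Q w)) + w * cnj w * (poly P' w * cnj (poly Q w))"
      by (simp add: P algebra_simps)
    then have "Re (poly P w * cnj (poly (pCons a Q) w))
        = Re (cnj a * poly P w) + Re (b * (cnj w * cnj (poly Q w))) + Re (poly P' w * cnj (poly Q w))"
      by (simp only: ww mult_1 plus_complex.sel)
    also have "Re (b * (cnj w * cnj (poly Q w))) = Re (cnj b * (w * poly Q w))"
      by (metis cnj.simps(1) complex_cnj_cnj complex_cnj_mult)
    finally show "Re (poly P w * cnj (poly (pCons a Q) w)) = Re (poly (smult (cnj a) P + smult (cnj b) (pCons 0 Q) + S) w)"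
      using S[OF w] by (simp add: algebra_simps)
  qed
qed

text \<open>By \<open>Re a * Re b = (Re (a * b) + Re (a * cnj b)) / 2\<close> and the previous
  lemma, real parts of polynomials form an algebra on the circle, which therefore contains every
  real polynomial in the coordinates.\<close>

lemma real_polynomial_function_eq_Re_poly:
  fixes g :: "complex \<Rightarrow> real"
  assumes "real_polynomial_function g"
  shows "\<exists>P. \<forall>w\<in>sphere 0 1. g w = Re (poly P w)"
  using assms
proof induction
  case (linear f)
  \<comment> \<open>A real linear functional on the plane is \<open>Re (c * w)\<close> with
    \<open>c = f 1 - \<i> * f \<i>\<close>.\<close>
  have "f w = Re (poly [:0, Complex (f 1) (- f \<i>):] w)" for w
  proof -
    interpret bounded_linear f by fact
    have "f w = f (Re w *\<^sub>R 1 + Im w *\<^sub>R \<i>)" by (rule arg_cong[of _ _ f]) (simp add: complex_eq_iff)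
    also have "\<dots> = Re w * f 1 + Im w * f \<i>" by (simp add: add scaleR)
    finally show ?thesis by simp
  qed
  then show ?case by blast
next
  case (const c)
  show ?case by (rule exI[of _ "[:of_real c:]"]) simp
next
  case (add f g)
  then obtain P Q where "\<forall>w\<in>sphere 0 1. f w = Re (poly P w)" "\<forall>w\<in>sphere 0 1. g w = Re (poly Q w)" by blast
  then show ?case by (intro exI[of _ "P + Q"]) simp
next
  case (mult f g)
  then obtain P Q where PQ: "\<forall>w\<in>sphere 0 1. f w = Re (poly P w)" "\<forall>w\<in>sphere 0 1. g w = Re (poly Q w)" by blast
  obtain S where S: "\<forall>w\<in>sphere 0 1. Re (poly P w * cnj (poly Q w)) = Re (poly S w)"
    using Re_poly_mult_cnj_poly_circle by blast
  have split: "Re a * Re b = (Re (a * b) + Re (a * cnj b)) / 2" for a b by simp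
  have "f w * g w = Re (poly (smult (1 / 2) (P * Q + S)) w)" if w: "w \<in> sphere 0 1" for w
  proof -
    have "f w * g w = (Re (poly P w * poly Q w) + Re (poly S w)) / 2"
      using PQ S w split by metis
    then show ?thesis by simp
  qed
  then show ?case by blast
qed

lemma Re_poly_dense:
  assumes "continuous_on (sphere 0 1) U" "0 < e"
  obtains P :: "complex poly" where "\<And>w. w \<in> sphere 0 1 \<Longrightarrow> \<bar>Re (poly P w) - U w\<bar> < e"
proof -
  obtain g where g: "real_polynomial_function g" "\<And>w. w \<in> sphere 0 1 \<Longrightarrow> \<bar>U w - g w\<bar> < e"
    using Stone_Weierstrass_real_polynomial_function[OF compact_sphere assms] by blast
  obtain P where "\<forall>w\<in>sphere 0 1. g w = Re (poly P w)"
    using real_polynomial_function_eq_Re_poly[OF g(1)] by blast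
  then show ?thesis using that[of P] g(2) by (simp add: abs_minus_commute)
qed

section \<open>Polynomials in the harmonic Hardy spaces\<close>

text \<open>The second derivative of \<open>Re P\<close> in the directions \<open>h\<close>,
  \<open>k\<close> is \<open>Re (P'' * h * k)\<close>; at \<open>h = k = 1\<close> and
  \<open>h = k = \<i>\<close> this is \<open>Re P''\<close> and \<open>- Re P''\<close>.\<close>

lemma Re_poly_harmonic_on:
  fixes P :: "complex poly"
  shows "(\<lambda>w. Re (poly P w)) harmonic_on S"
proof -
  \<comment> \<open>Encodes \<open>c\<close> as the functional taking \<open>h\<close> to
    \<open>Re (c * h)\<close>; being linear in \<open>c\<close>, it can be differentiated along
    \<open>P'\<close>.\<close>
  define \<Phi> where "\<Phi> c = Blinfun Re o\<^sub>L blinfun_mult_right c" for c :: complex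
  have bl: "bounded_linear \<Phi>"
    unfolding \<Phi>_def
    by (intro bounded_linear_compose[OF bounded_bilinear.bounded_linear_right[OF bounded_bilinear_blinfun_compose]]
        bounded_linear_blinfun_mult_right)
  have app: "blinfun_apply (\<Phi> c) = (\<lambda>h. Re (c * h))" for c
    by (rule ext) (simp add: \<Phi>_def bounded_linear_Blinfun_apply bounded_linear_Re)
  define u'' where "u'' z = Blinfun \<Phi> o\<^sub>L blinfun_mult_right (poly (pderiv (pderiv P)) z)" for z
  have app2: "blinfun_apply (u'' z) = (\<lambda>h. \<Phi> (poly (pderiv (pderiv P)) z * h))" for z
    by (rule ext) (simp add: u''_def bounded_linear_Blinfun_apply bl)
  have deriv: "(poly Q has_derivative (\<lambda>h. poly (pderiv Q) z * h)) (at z)" for Q :: "complex poly" and z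
    using poly_DERIV[of Q z] by (simp add: has_field_derivative_def)
  have "((\<lambda>w. Re (poly P w)) has_derivative blinfun_apply (\<Phi> (poly (pderiv P) z))) (at z)" for z
    unfolding app by (rule bounded_linear.has_derivative[OF bounded_linear_Re deriv])
  moreover have "((\<lambda>z. \<Phi> (poly (pderiv P) z)) has_derivative blinfun_apply (u'' z)) (at z)" for z
    unfolding app2 by (rule bounded_linear.has_derivative[OF bl deriv])
  moreover have "continuous_on S u''"
    unfolding u''_def
    by (intro continuous_intros bounded_linear.continuous_on[OF bounded_linear_blinfun_mult_right])
  moreover have "blinfun_apply (blinfun_apply (u'' z) 1) 1 + blinfun_apply (blinfun_apply (u'' z) \<i>) \<i> = 0" for z
    by (simp add: app app2)
  ultimately show ?thesis unfolding harmonic_on_def by (intro exI[of _ "\<lambda>z. \<Phi> (poly (pderiv P) z)"] exI[of _ u'']) blast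
qed

text \<open>The maximum principle again, now with \<open>b\<close> as a complex dilation factor. On
  the unit circle \<open>b\<close> is a rotation, which preserves the norm; inside, the mean value
  property gives the sub-mean inequality.\<close>

lemma circle_norm_Re_poly_dilation:
  fixes P :: "complex poly"
  assumes p: "1 \<le> p" and b: "b \<in> cball 0 1"
  shows "circle_norm p (\<lambda>w. Re (poly P (b * w))) \<le> circle_norm p (\<lambda>w. Re (poly P w))"
proof (rule circle_norm_max_principle[where G = "\<lambda>b w. Re (poly P (b * w))", OF _ _ _ p b])
  show "continuous_on (cball 0 1 \<times> sphere 0 1) (\<lambda>(b, w). Re (poly P (b * w)))"
    unfolding split_beta by (intro continuous_intros)
  show "circle_norm p (\<lambda>w. Re (poly P (b * w))) \<le> circle_norm p (\<lambda>w. Re (poly P w))" if "b \<in> sphere 0 1" for b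
    using circle_norm_rotate[OF _ that p, of "\<lambda>w. Re (poly P w)"] by (simp add: continuous_intros)
  fix a :: complex assume a: "a \<in> ball 0 1"
  define e where "e = (1 - cmod a) / 2"
  have "2 * pi * \<bar>Re (poly P (a * w))\<bar> \<le> circle_int (\<lambda>v. \<bar>Re (poly P ((a + of_real e * v) * w))\<bar>)" for w
  proof -
    have "circle_int (\<lambda>v. Re (poly P ((a + of_real e * v) * w))) = 2 * pi * Re (poly P (a * w))"
      using circle_mean_value_Re[of "\<lambda>v. poly P ((a + of_real e * v) * w)"]
      by (simp add: continuous_intros holomorphic_intros)
    moreover have "\<bar>circle_int (\<lambda>v. Re (poly P ((a + of_real e * v) * w)))\<bar> \<le> circle_int (\<lambda>v. \<bar>Re (poly P ((a + of_real e * v) * w))\<bar>)"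
      by (intro circle_int_abs_le continuous_intros)
    ultimately show ?thesis by (simp add: abs_mult)
  qed
  moreover have "0 < e" "e < 1 - cmod a" using a by (simp_all add: e_def)
  ultimately show "\<exists>\<epsilon>>0. \<epsilon> < 1 - cmod a \<and> (\<forall>w\<in>sphere 0 1. 2 * pi * \<bar>Re (poly P (a * w))\<bar>
      \<le> circle_int (\<lambda>v. \<bar>Re (poly P ((a + of_real \<epsilon> * v) * w))\<bar>))" by blast
qed

lemma Re_poly_hp:
  fixes P :: "complex poly"
  assumes p: "1 \<le> p"
  shows "(\<lambda>w. Re (poly P w)) \<in> hp p"
    and "hp_norm p (\<lambda>w. Re (poly P w)) \<le> circle_norm p (\<lambda>w. Re (poly P w))"
proof -
  let ?u = "\<lambda>w. Re (poly P w)"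
  have cu: "continuous_on S ?u" for S by (intro continuous_intros)
  have "?u \<in> hp p \<and> hp_norm p ?u \<le> circle_norm p ?u"
  proof (cases p rule: ennreal_cases)
    case top
    have le: "\<bar>?u z\<bar> \<le> circle_norm p ?u" if "z \<in> ball 0 1" for z
    proof -
      \<comment> \<open>The point \<open>z\<close> is read as the dilation factor, with the circle
        variable at \<open>1\<close>.\<close>
      have "\<bar>Re (poly P (z * 1))\<bar> \<le> circle_norm \<infinity> (\<lambda>w. Re (poly P (z * w)))"
        by (rule abs_le_circle_norm_top[of "\<lambda>w. Re (poly P (z * w))"]) (auto intro!: continuous_intros)
      also have "\<dots> \<le> circle_norm p ?u"
        using circle_norm_Re_poly_dilation[OF p, of z P] that top by auto
      finally show ?thesis by simp
    qed
    then have "bdd_above ((\<lambda>z. \<bar>?u z\<bar>) ` ball 0 1)" by (intro bdd_aboveI2)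
    moreover have "(SUP z\<in>ball 0 1. \<bar>?u z\<bar>) \<le> circle_norm p ?u" using le by (intro cSUP_least) auto
    ultimately show ?thesis using top Re_poly_harmonic_on[of P] by (simp add: hp_def hp_norm_def)
  next
    case (real Q)
    then have Q: "Q \<ge> 1" using p by simp
    define M where "M = circle_norm p ?u"
    have M: "M \<ge> 0" unfolding M_def by (rule circle_norm_nonneg[OF cu])
    have nn: "0 \<le> circle_integral Q ?u r" for r
      unfolding circle_integral_eq using Q by (intro circle_int_nonneg continuous_on_abs_powr continuous_intros) auto
    have le: "circle_integral Q ?u r \<le> M powr Q" if "r \<in> {0<..<1}" for r
    proof -
      have "circle_norm p (\<lambda>w. Re (poly P (of_real r * w))) \<le> M"
        unfolding M_def using that by (intro circle_norm_Re_poly_dilation p) auto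
      then have "circle_integral Q ?u r powr (1 / Q) \<le> M"
        using real Q by (simp add: circle_norm_real circle_integral_eq)
      then have "(circle_integral Q ?u r powr (1 / Q)) powr Q \<le> M powr Q"
        using Q by (intro powr_mono2) auto
      then show ?thesis using nn[of r] Q by (simp add: powr_powr)
    qed
    then have bdd: "bdd_above (circle_integral Q ?u ` {0<..<1})" by (intro bdd_aboveI2)
    have "(SUP r\<in>{0<..<1}. circle_integral Q ?u r) \<le> M powr Q" using le by (intro cSUP_least) auto
    moreover have "0 \<le> (SUP r\<in>{0<..<1}. circle_integral Q ?u r)"
      using nn[of "1 / 2"] cSUP_upper[OF _ bdd, of "1 / 2"] by simp
    ultimately have "(SUP r\<in>{0<..<1}. circle_integral Q ?u r) powr (1 / Q) \<le> (M powr Q) powr (1 / Q)"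
      using Q by (intro powr_mono2) auto
    then show ?thesis using real Q M bdd Re_poly_harmonic_on[of P] by (simp add: hp_def hp_norm_def powr_powr M_def)
  qed
  then show "?u \<in> hp p" "hp_norm p ?u \<le> circle_norm p ?u" by auto
qed

section \<open>The lower bound for admissible constants\<close>

lemma hp_norm_one_pos:
  assumes "1 \<le> p"
  shows "0 < hp_norm p (\<lambda>w. 1)"
proof (cases p rule: ennreal_cases)
  case (real P)
  then show ?thesis using assms by (simp add: hp_norm_def circle_integral_def)
qed (simp add: hp_norm_def)

text \<open>At each \<open>z\<close> the hypothesis on polynomials bounds the norm of
  \<open>deriv_kernel\<close>. The power of \<open>1 - (cmod z)\<^sup>2\<close> in the hypothesis is
  the one produced by the Moebius substitution, so it cancels and leaves a bound on
  \<open>disc_kernel\<close> free of \<open>z\<close>.\<close>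

lemma sharp_const_le:
  assumes pq: "1 \<le> p" "1 / p + 1 / q = 1" and n: "1 \<le> n"
    and K: "\<And>P z. z \<in> ball 0 1 \<Longrightarrow> cmod ((deriv ^^ n) (poly P) z)
      \<le> K * (1 - (cmod z)\<^sup>2) powr (- enn2real (1 / p) - real n) * hp_norm p (\<lambda>w. Re (poly P w))"
  shows "sharp_const q n \<le> K"
proof -
  note q = conjugate_exponents_enn2real[OF pq]
  \<comment> \<open>The constant polynomial \<open>1\<close> at \<open>z = 0\<close>, where the
    weight is \<open>1\<close>, forces \<open>K\<close> to be nonnegative.\<close>
  have "0 \<le> K * hp_norm p (\<lambda>w. Re (poly 1 w))"
    using order.trans[OF norm_ge_zero K[of 0 1]] by simp
  then have K0: "K \<ge> 0" using hp_norm_one_pos[OF pq(1)] by (simp add: zero_le_mult_iff)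
  have disc: "circle_norm q (disc_kernel q n \<theta> (of_real r)) \<le> K * pi / fact n" if r: "0 \<le> r" "r < 1" for r \<theta>
  proof -
    define z where "z = complex_of_real r"
    define s where "s = (1 - (cmod z)\<^sup>2) powr (- enn2real (1 / p) - real n)"
    have z: "cmod z < 1" "cnj z = z" using r by (simp_all add: z_def)
    have "(cmod z)\<^sup>2 < 1" using z(1) by (simp add: power_less_one_iff abs_square_less_1)
    then have s: "s > 0" by (simp add: s_def)
    note ck = continuous_on_deriv_kernel[OF z(1), of n \<theta>]
    have poly: "circle_int (\<lambda>w. Re (poly P w) * deriv_kernel n \<theta> z w) \<le> K * s * pi / fact n * circle_norm p (\<lambda>w. Re (poly P w))" for P
    proof -
      have "fact n / pi * circle_int (\<lambda>w. Re (poly P w) * deriv_kernel n \<theta> z w) = Re (cis \<theta> * (deriv ^^ n) (poly P) z)"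
        by (rule Re_higher_deriv_eq_circle_int[symmetric, of _ 2]) (use n z in \<open>auto intro!: holomorphic_intros\<close>)
      also have "\<dots> \<le> cmod ((deriv ^^ n) (poly P) z)"
        using complex_Re_le_cmod[of "cis \<theta> * (deriv ^^ n) (poly P) z"] by (simp add: norm_mult)
      also have "\<dots> \<le> K * s * hp_norm p (\<lambda>w. Re (poly P w))"
        unfolding s_def using z by (intro K) auto
      also have "\<dots> \<le> K * s * circle_norm p (\<lambda>w. Re (poly P w))"
        using K0 s by (intro mult_left_mono Re_poly_hp pq) auto
      finally show ?thesis by (simp add: field_simps)
    qed
    have "circle_norm q (deriv_kernel n \<theta> z) \<le> K * s * pi / fact n"
    proof (rule circle_norm_le_dual[OF pq ck])
      fix U :: "complex \<Rightarrow> real" assume U: "continuous_on (sphere 0 1) U"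
      have "\<exists>P. \<forall>w\<in>sphere 0 1. \<bar>Re (poly P w) - U w\<bar> \<le> 1 / real (Suc j)" for j
      proof -
        have "0 < 1 / real (Suc j)" by simp
        from Re_poly_dense[OF U this] show ?thesis by (meson less_imp_le)
      qed
      then obtain P where P: "\<And>j w. w \<in> sphere 0 1 \<Longrightarrow> \<bar>Re (poly (P j) w) - U w\<bar> \<le> 1 / real (Suc j)" by metis
      have cP: "continuous_on S (\<lambda>w. Re (poly (P j) w))" for j S by (intro continuous_intros)
      have "(\<lambda>j. circle_norm p (\<lambda>w. Re (poly (P j) w))) \<longlonglongrightarrow> circle_norm p U"
        by (rule circle_norm_tendsto[OF cP U pq(1) P])
      then have lim1: "(\<lambda>j. K * s * pi / fact n * circle_norm p (\<lambda>w. Re (poly (P j) w))) \<longlonglongrightarrow> K * s * pi / fact n * circle_norm p U"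
        by (intro tendsto_intros)
      have lim2: "(\<lambda>j. circle_int (\<lambda>w. Re (poly (P j) w) * deriv_kernel n \<theta> z w)) \<longlonglongrightarrow> circle_int (\<lambda>w. U w * deriv_kernel n \<theta> z w)"
        unfolding circle_int_def
      proof (rule dominated_convergence(2))
        show "(\<lambda>t. Re (poly (P j) (cis t)) * deriv_kernel n \<theta> z (cis t)) integrable_on {0..2 * pi}" for j
          by (intro circle_integrable[of "\<lambda>w. Re (poly (P j) w) * deriv_kernel n \<theta> z w"] continuous_on_mult cP ck)
        show "(\<lambda>t. (\<bar>U (cis t)\<bar> + 1) * \<bar>deriv_kernel n \<theta> z (cis t)\<bar>) integrable_on {0..2 * pi}"
          by (intro circle_integrable[of "\<lambda>w. (\<bar>U w\<bar> + 1) * \<bar>deriv_kernel n \<theta> z w\<bar>"] continuous_intros U ck)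
        show "norm (Re (poly (P j) (cis t)) * deriv_kernel n \<theta> z (cis t)) \<le> (\<bar>U (cis t)\<bar> + 1) * \<bar>deriv_kernel n \<theta> z (cis t)\<bar>" for j t
        proof -
          have "\<bar>Re (poly (P j) (cis t)) - U (cis t)\<bar> \<le> 1"
            by (rule order.trans[OF P]) auto
          then show ?thesis by (auto simp: abs_mult intro!: mult_right_mono)
        qed
        show "(\<lambda>j. Re (poly (P j) (cis t)) * deriv_kernel n \<theta> z (cis t)) \<longlonglongrightarrow> U (cis t) * deriv_kernel n \<theta> z (cis t)" for t
          by (intro tendsto_mult tendsto_const tendsto_of_abs_le P) simp
      qed
      show "circle_int (\<lambda>w. U w * deriv_kernel n \<theta> z w) \<le> K * s * pi / fact n * circle_norm p U"
        by (rule LIMSEQ_le[OF lim2 lim1]) (use poly in blast)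
    qed
    moreover have "circle_norm q (deriv_kernel n \<theta> z) = s * circle_norm q (disc_kernel q n \<theta> z)"
    proof -
      have e: "enn2real (1 / q) - real n - 1 = - enn2real (1 / p) - real n" using q(1) by linarith
      show ?thesis using circle_norm_deriv_kernel[OF q(2) z(1) n, of \<theta>] unfolding e s_def z(2) .
    qed
    ultimately have "s * circle_norm q (disc_kernel q n \<theta> z) \<le> s * (K * pi / fact n)" by (simp add: mult_ac)
    then show ?thesis by (simp only: mult_le_cancel_left_pos[OF s] z_def)
  qed
  \<comment> \<open>The parameter \<open>1\<close> belongs to no point of the open disc; it is
    reached through continuity of the norm on the closed disc.\<close>
  have lim: "circle_norm q (disc_kernel q n \<theta> 1) \<le> K * pi / fact n" for \<theta>
  proof -
    define R where "R j = 1 - 1 / real (Suc j)" for j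
    have R: "0 \<le> R j" "R j < 1" for j by (auto simp: R_def)
    have "R \<longlonglongrightarrow> 1" by (rule tendsto_of_abs_le) (simp add: R_def)
    then have "(\<lambda>j. complex_of_real (R j)) \<longlonglongrightarrow> 1" using tendsto_of_real[OF \<open>R \<longlonglongrightarrow> 1\<close>] by simp
    moreover have "continuous_on (cball 0 1) (\<lambda>b. circle_norm q (disc_kernel q n \<theta> b))"
      by (rule continuous_on_circle_norm[OF continuous_on_disc_kernel[OF q(2)] compact_cball q(2)])
    moreover have "complex_of_real (R j) \<in> cball 0 1" for j using R[of j] by simp
    ultimately have "(\<lambda>j. circle_norm q (disc_kernel q n \<theta> (of_real (R j)))) \<longlonglongrightarrow> circle_norm q (disc_kernel q n \<theta> 1)"
      by (intro continuous_on_tendsto_compose[of "cball 0 1" "\<lambda>b. circle_norm q (disc_kernel q n \<theta> b)"]) simp_all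
    then show ?thesis by (rule LIMSEQ_le_const2) (use disc[OF R] in blast)
  qed
  \<comment> \<open>The supremum is attained at some \<open>\<beta>\<close>, so the single phase
    \<open>- \<beta>\<close> suffices.\<close>
  obtain \<beta> where \<beta>: "\<beta> \<in> {0..pi / 2}" "\<forall>\<beta>'\<in>{0..pi / 2}. F_root q n \<beta>' \<le> F_root q n \<beta>"
    using F_root_attains_max[OF q(2) n] by blast
  have "(SUP \<beta>\<in>{0..pi / 2}. F_root q n \<beta>) \<le> F_root q n \<beta>"
    using \<beta>(2) by (intro cSUP_least) auto
  then have "2 powr (real n + 1 - enn2real (1 / q)) * (SUP \<beta>\<in>{0..pi / 2}. F_root q n \<beta>)
      \<le> 2 powr (real n + 1 - enn2real (1 / q)) * F_root q n \<beta>"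
    by (rule mult_left_mono) simp
  also have "\<dots> \<le> K * pi / fact n"
    using lim[of "- \<beta>"] circle_norm_disc_kernel_one[OF q(2) n, of \<beta>] by simp
  finally have "fact n / pi * (2 powr (real n + 1 - enn2real (1 / q)) * (SUP \<beta>\<in>{0..pi / 2}. F_root q n \<beta>))
      \<le> fact n / pi * (K * pi / fact n)"
    by (rule mult_left_mono) simp
  then show ?thesis unfolding sharp_const_def by (simp add: mult.assoc)
qed

theorem theorem1p2:
  fixes p q :: ennreal and n :: nat
  assumes "1 \<le> p" and "1 / p + 1 / q = 1" and "1 \<le> n"
  shows
    \<comment> \<open>the supremum in the constant is a maximum\<close>
    "(\<exists>\<beta>\<in>{0..pi / 2}. \<forall>\<beta>'\<in>{0..pi / 2}. F_root q n \<beta>' \<le> F_root q n \<beta>)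
   \<and> (\<forall>(f :: complex \<Rightarrow> complex) (P :: complex poly) z.
        f holomorphic_on ball 0 1 \<and> (\<lambda>w. Re (f w)) \<in> hp p \<and>
        degree P \<le> n - 1 \<and> z \<in> ball 0 1 \<longrightarrow>
        cmod ((deriv ^^ n) f z)
          \<le> sharp_const q n * (1 - (cmod z)\<^sup>2) powr (- enn2real (1 / p) - real n)
             * hp_norm p (\<lambda>w. Re (f w - poly P w)))
   \<and> (\<forall>K < sharp_const q n. \<exists>(f :: complex \<Rightarrow> complex) (P :: complex poly) z.
        f holomorphic_on ball 0 1 \<and> (\<lambda>w. Re (f w)) \<in> hp p \<and>
        degree P \<le> n - 1 \<and> z \<in> ball 0 1 \<and>
        cmod ((deriv ^^ n) f z)
          > K * (1 - (cmod z)\<^sup>2) powr (- enn2real (1 / p) - real n)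
             * hp_norm p (\<lambda>w. Re (f w - poly P w)))
   \<and> (\<forall>(f :: complex \<Rightarrow> complex) z.
        f holomorphic_on ball 0 1 \<and> (\<lambda>w. Re (f w)) \<in> hp p \<and> z \<in> ball 0 1 \<longrightarrow>
        cmod ((deriv ^^ n) f z)
          \<le> sharp_const q n * (1 - (cmod z)\<^sup>2) powr (- enn2real (1 / p) - real n)
             * best_approx_Re (n - 1) p f)"
proof (intro conjI allI impI)
  show "\<exists>\<beta>\<in>{0..pi / 2}. \<forall>\<beta>'\<in>{0..pi / 2}. F_root q n \<beta>' \<le> F_root q n \<beta>"
    by (rule F_root_attains_max[OF conjugate_exponents_enn2real(2)[OF assms(1,2)] assms(3)])
next
  fix f :: "complex \<Rightarrow> complex" and P :: "complex poly" and z :: complex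
  assume "f holomorphic_on ball 0 1 \<and> (\<lambda>w. Re (f w)) \<in> hp p \<and> degree P \<le> n - 1 \<and> z \<in> ball 0 1"
  then show "cmod ((deriv ^^ n) f z) \<le> sharp_const q n * (1 - (cmod z)\<^sup>2) powr (- enn2real (1 / p) - real n)
      * hp_norm p (\<lambda>w. Re (f w - poly P w))"
    by (intro higher_deriv_le_hp_norm_diff_poly assms) auto
next
  fix K assume K: "K < sharp_const q n"
  \<comment> \<open>If every polynomial obeyed the bound with \<open>K\<close>, then
    \<open>sharp_const_le\<close> would give \<open>sharp_const q n \<le> K\<close>. A violating
    polynomial serves as \<open>f\<close>, with \<open>0\<close> as the approximating one.\<close>
  have "\<not> (\<forall>(P :: complex poly) z. z \<in> ball 0 1 \<longrightarrow> cmod ((deriv ^^ n) (poly P) z)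
      \<le> K * (1 - (cmod z)\<^sup>2) powr (- enn2real (1 / p) - real n) * hp_norm p (\<lambda>w. Re (poly P w)))"
    (is "\<not> (\<forall>P z. ?A z \<longrightarrow> ?L P z \<le> ?R P z)")
  proof
    assume *: "\<forall>P z. ?A z \<longrightarrow> ?L P z \<le> ?R P z"
    have "sharp_const q n \<le> K" by (rule sharp_const_le[OF assms *[rule_format]])
    then show False using K by simp
  qed
  then obtain Q z where Q: "z \<in> ball 0 1" "cmod ((deriv ^^ n) (poly Q) z)
      > K * (1 - (cmod z)\<^sup>2) powr (- enn2real (1 / p) - real n) * hp_norm p (\<lambda>w. Re (poly Q w))"
    by (auto simp only: not_all not_imp not_le)
  show "\<exists>(f :: complex \<Rightarrow> complex) (P :: complex poly) z. f holomorphic_on ball 0 1 \<and> (\<lambda>w. Re (f w)) \<in> hp p \<and>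
        degree P \<le> n - 1 \<and> z \<in> ball 0 1 \<and>
        cmod ((deriv ^^ n) f z) > K * (1 - (cmod z)\<^sup>2) powr (- enn2real (1 / p) - real n)
             * hp_norm p (\<lambda>w. Re (f w - poly P w))"
    using Q Re_poly_hp(1)[OF assms(1), of Q]
    by (intro exI[of _ "poly Q"] exI[of _ "0 :: complex poly"] exI[of _ z]) (auto intro!: holomorphic_intros)
next
  fix f :: "complex \<Rightarrow> complex" and z :: complex
  assume f: "f holomorphic_on ball 0 1 \<and> (\<lambda>w. Re (f w)) \<in> hp p \<and> z \<in> ball 0 1"
  define c where "c = sharp_const q n * (1 - (cmod z)\<^sup>2) powr (- enn2real (1 / p) - real n)"
  define N where "N P = hp_norm p (\<lambda>w. Re (f w - poly P w))" for P
  have le: "cmod ((deriv ^^ n) f z) \<le> c * N P" if "degree P \<le> n - 1" for P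
    unfolding c_def N_def using f that by (intro higher_deriv_le_hp_norm_diff_poly assms) auto
  have c0: "0 \<le> c"
    unfolding c_def by (intro mult_nonneg_nonneg sharp_const_nonneg[OF conjugate_exponents_enn2real(2)[OF assms(1,2)] assms(3)]) auto
  \<comment> \<open>The infimum is taken after dividing by \<open>c\<close>, so \<open>c = 0\<close>
    is treated apart; there the bound for a single polynomial already gives the claim.\<close>
  have "cmod ((deriv ^^ n) f z) \<le> c * (INF P\<in>{P. degree P \<le> n - 1}. N P)"
  proof (cases "c = 0")
    case True
    then show ?thesis using le[of 0] by simp
  next
    case False
    have "cmod ((deriv ^^ n) f z) / c \<le> (INF P\<in>{P. degree P \<le> n - 1}. N P)"
      using le c0 False by (intro cINF_greatest) (auto simp: field_simps intro: exI[of _ 0])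
    then show ?thesis using c0 False by (simp add: field_simps)
  qed
  then show "cmod ((deriv ^^ n) f z) \<le> sharp_const q n * (1 - (cmod z)\<^sup>2) powr (- enn2real (1 / p) - real n)
             * best_approx_Re (n - 1) p f"
    by (simp add: c_def N_def best_approx_Re_def)
qed

end
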